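(* Let $\theta\in(0,\pi/2)$. There exists a positive constant $C$, depending only on $n$ and $\theta$, such that for every capillary convex body $\widehat\Sigma\in\mathcal{K}_\theta$ in $\overline{\mathbb{R}^{n+1}_+}$, $$\rho_+(\widehat\Sigma,\theta)\le C e^{\mathcal{E}_\theta(\widehat\Sigma)}\qquad\text{and}\qquad \rho_-(\widehat\Sigma,\theta)\ge C^{-1}\,\mathrm{Vol}(\widehat\Sigma)\,e^{-n\mathcal{E}_\theta(\widehat\Sigma)}.$$
   Context: $\mathbb{R}^{n+1}_+=\{x\in\mathbb{R}^{n+1}: x_{n+1}>0\}$, $e:=-E_{n+1}$ with $E_{n+1}$ the $(n+1)$-th coordinate vector. A capillary hypersurface with contact angle $\theta$ is a properly embedded, smooth, compact hypersurface $\Sigma\subset\overline{\mathbb{R}^{n+1}_+}$ with $\partial\Sigma\subset\partial\mathbb{R}^{n+1}_+$ such that $\langle\nu,e\rangle=-\cos\theta$ along $\partial\Sigma$, $\nu$ being the unit outward normal. $\widehat\Sigma$ is the bounded closed region enclosed by $\Sigma$ and $\partial\mathbb{R}^{n+1}_+$; its flat boundary part is $\widehat{\partial\Sigma}=\widehat\Sigma\cap\partial\mathbb{R}^{n+1}_+$, with interior taken relative to $\partial\mathbb{R}^{n+1}_+$. $\mathcal{K}_\theta$ is the set of all such $\widehat\Sigma$ that are convex. For $r>0$ and $x_0\in\partial\mathbb{R}^{n+1}_+$ let $\mathcal{C}_{r,\theta}(x_0):=\{x\in\overline{\mathbb{R}^{n+1}_+}:|x-(x_0+r\cos\theta\, e)|=r\}$,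 and $\mathcal{C}_\theta:=\mathcal{C}_{1,\theta}(0)$. The capillary inner and outer radii are $\rho_-(\widehat\Sigma,\theta):=\sup\{r>0:\widehat{\mathcal{C}_{r,\theta}(x_0)}\subset\widehat\Sigma\text{ for some }x_0\in\partial\mathbb{R}^{n+1}_+\}$ and $\rho_+(\widehat\Sigma,\theta):=\inf\{r>0:\widehat\Sigma\subset\widehat{\mathcal{C}_{r,\theta}(x_0)}\text{ for some }x_0\in\partial\mathbb{R}^{n+1}_+\}$. On $\mathcal{C}_\theta$ let $\ell(\xi):=\sin^2\theta+\cos\theta\langle\xi,e\rangle$, and for $z\in\widehat\Sigma$ let $u_z(\xi):=\ell(\xi)^{-1}\max_{X\in\Sigma}\langle\xi-\cos\theta\, e,X-z\rangle$ be the capillary support function. The capillary entropy is $$\mathcal{E}_\theta(\widehat\Sigma):=\sup_{z\in\mathrm{int}(\widehat{\partial\Sigma})}\frac1{\omega_\theta}\int_{\mathcal{C}_\theta}\log u_z(\xi)\,\ell(\xi)\,d\sigma,\qquad \omega_\theta:=|\mathcal{C}_\theta|-\cos\theta\,|\widehat{\partial\mathcal{C}_\theta}|,$$ where $d\sigma$ is the area element of $\mathcal{C}_\theta$. *)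

theory Defs
  imports "HOL-Analysis.Analysis"
begin

text \<open>
  The space \<open>R^(n+1)\<close> is \<open>real^'n \<times> real\<close> with \<open>n = CARD('n)\<close>; the last coordinate is \<open>snd\<close>.
\<close>

type_synonym 'n amb = "(real^'n) \<times> real"

definition closed_halfspace :: "'n::finite amb set" where
  "closed_halfspace = {x. 0 \<le> snd x}"

definition bdry_plane :: "'n::finite amb set" where
  "bdry_plane = {x. snd x = 0}"

definition e_vec :: "'n::finite amb" where
  "e_vec = - (0, 1)"

fun Ck_on :: "nat \<Rightarrow> 'a::euclidean_space set \<Rightarrow> ('a \<Rightarrow> 'b::real_normed_vector) \<Rightarrow> bool" where
  "Ck_on 0 U f \<longleftrightarrow> continuous_on U f"
| "Ck_on (Suc k) U f \<longleftrightarrow>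
     (\<forall>x\<in>U. f differentiable (at x)) \<and> (\<forall>v. Ck_on k U (\<lambda>x. frechet_derivative f (at x) v))"

definition smooth_on :: "'a::euclidean_space set \<Rightarrow> ('a \<Rightarrow> 'b::real_normed_vector) \<Rightarrow> bool" where
  "smooth_on U f \<longleftrightarrow> (\<forall>k. Ck_on k U f)"

text \<open>A diffeomorphism \<open>\<phi>\<close> from a neighbourhood of \<open>p\<close> onto an open set, carrying \<open>S\<close> to the model set \<open>M\<close>.\<close>

definition slice_chart :: "'n::finite amb set \<Rightarrow> 'n amb set \<Rightarrow> 'n amb \<Rightarrow> ('n amb \<Rightarrow> 'n amb) \<Rightarrow> bool" where
  "slice_chart S M p \<phi> \<longleftrightarrow>
     (\<exists>U V \<psi>. open U \<and> open V \<and> p \<in> U \<and> homeomorphism U V \<phi> \<psi> \<and>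
        smooth_on U \<phi> \<and> smooth_on V \<psi> \<and> \<phi> ` (S \<inter> U) = V \<inter> M)"

definition mfd_interior :: "'n::finite amb set \<Rightarrow> 'n amb set" where
  "mfd_interior S = {p \<in> S. \<exists>\<phi>. slice_chart S {y. snd y = 0} p \<phi>}"

definition mfd_boundary :: "'n::finite amb set \<Rightarrow> 'n amb set" where
  "mfd_boundary S =
     {p \<in> S. \<exists>\<phi> k. slice_chart S {y. snd y = 0 \<and> 0 \<le> fst y $ k} p \<phi> \<and> fst (\<phi> p) $ k = 0}"

definition smooth_hypersurface :: "'n::finite amb set \<Rightarrow> bool" where
  "smooth_hypersurface S \<longleftrightarrow> S = mfd_interior S \<union> mfd_boundary S"

text \<open>
  Velocities are one-sided so that the definition also yields the full \<open>n\<close>-dimensional tangent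
  space at a point of the manifold boundary.
\<close>

definition tangent_space :: "'n::finite amb set \<Rightarrow> 'n amb \<Rightarrow> 'n amb set" where
  "tangent_space S p = span {v. \<exists>\<gamma> \<epsilon>. 0 < \<epsilon> \<and> \<gamma> 0 = p \<and> (\<forall>t\<in>{0..<\<epsilon>}. \<gamma> t \<in> S) \<and>
     (\<gamma> has_vector_derivative v) (at_right (0::real))}"

text \<open>
  \<open>inside T\<close> is the union of the bounded components of the complement of \<open>T\<close>, so the following is
  the bounded closed region enclosed by \<open>S\<close> and the plane.
\<close>

definition enclosed :: "'n::finite amb set \<Rightarrow> 'n amb set" where
  "enclosed S = closure (inside (S \<union> bdry_plane))"

text \<open>
  The outward direction is tested at the points of \<open>S\<close> above the plane; at \<open>S \<inter> bdry_plane\<close>, where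
  one of the two unit normals points below the plane, it is inherited by continuity.
\<close>

definition outward_unit_normal :: "'n::finite amb set \<Rightarrow> ('n amb \<Rightarrow> 'n amb) \<Rightarrow> bool" where
  "outward_unit_normal S \<nu> \<longleftrightarrow>
     continuous_on S \<nu> \<and>
     (\<forall>p\<in>S. norm (\<nu> p) = 1 \<and> (\<forall>v\<in>tangent_space S p. \<nu> p \<bullet> v = 0)) \<and>
     (\<forall>p\<in>S. 0 < snd p \<longrightarrow>
        (\<forall>\<^sub>F t in at_right 0. p + t *\<^sub>R \<nu> p \<notin> enclosed S \<and> p - t *\<^sub>R \<nu> p \<in> enclosed S))"

text \<open>
  Proper embeddedness means that \<open>S\<close> meets the plane exactly in its manifold boundary. Hypersurfaces
  are connected and their boundary is nonempty (otherwise a round sphere above the plane would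
  satisfy the contact angle condition vacuously).
\<close>

definition capillary_hypersurface :: "real \<Rightarrow> 'n::finite amb set \<Rightarrow> bool" where
  "capillary_hypersurface \<theta> S \<longleftrightarrow>
     smooth_hypersurface S \<and> compact S \<and> connected S \<and> S \<subseteq> closed_halfspace \<and>
     mfd_boundary S \<noteq> {} \<and> mfd_boundary S = S \<inter> bdry_plane \<and>
     (\<exists>\<nu>. outward_unit_normal S \<nu> \<and> (\<forall>p\<in>mfd_boundary S. \<nu> p \<bullet> e_vec = - cos \<theta>))"

definition flat_part :: "'n::finite amb set \<Rightarrow> 'n amb set" where
  "flat_part K = K \<inter> bdry_plane"

definition cap :: "real \<Rightarrow> real \<Rightarrow> 'n::finite amb \<Rightarrow> 'n amb set" where
  "cap r \<theta> x0 = {x \<in> closed_halfspace. norm (x - (x0 + (r * cos \<theta>) *\<^sub>R e_vec)) = r}"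

definition inner_radius :: "real \<Rightarrow> 'n::finite amb set \<Rightarrow> real" where
  "inner_radius \<theta> K = Sup {r. 0 < r \<and> (\<exists>x0\<in>bdry_plane. enclosed (cap r \<theta> x0) \<subseteq> K)}"

definition outer_radius :: "real \<Rightarrow> 'n::finite amb set \<Rightarrow> real" where
  "outer_radius \<theta> K = Inf {r. 0 < r \<and> (\<exists>x0\<in>bdry_plane. K \<subseteq> enclosed (cap r \<theta> x0))}"

definition gram_matrix :: "(real^'n::finite \<Rightarrow> 'n amb) \<Rightarrow> real^'n \<Rightarrow> real^'n^'n" where
  "gram_matrix F y =
     (\<chi> i j. frechet_derivative F (at y) (axis i 1) \<bullet> frechet_derivative F (at y) (axis j 1))"

text \<open>The Riemannian area measure \<open>\<surd>(det g) dy\<close> of the hypersurface parametrized by the injective map \<open>F\<close> on \<open>D\<close>.\<close>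

definition area_measure :: "(real^'n::finite \<Rightarrow> 'n amb) \<Rightarrow> (real^'n) set \<Rightarrow> 'n amb measure" where
  "area_measure F D =
     distr (density (restrict_space lborel D) (\<lambda>y. ennreal (sqrt (det (gram_matrix F y))))) borel F"

text \<open>For \<open>0 < \<theta> < \<pi>/2\<close> the whole unit cap is a graph over the disc of radius \<open>sin \<theta>\<close>.\<close>

definition cap_param :: "real \<Rightarrow> real^'n::finite \<Rightarrow> 'n amb" where
  "cap_param \<theta> y = (y, sqrt (1 - (norm y)\<^sup>2) - cos \<theta>)"

lemma inj_cap_param: "inj (cap_param \<theta>)"
  by (auto simp: inj_def cap_param_def)

lemma cap_param_image:
  assumes "0 < \<theta>" "\<theta> < pi / 2"
  shows "cap_param \<theta> ` cball 0 (sin \<theta>) = cap 1 \<theta> (0 :: 'n::finite amb)"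
proof -
  have c: "0 < cos \<theta>" and s: "0 < sin \<theta>"
    using assms by (auto intro: cos_gt_zero sin_gt_zero)
  have sc: "(sin \<theta>)\<^sup>2 = 1 - (cos \<theta>)\<^sup>2"
    by (rule sin_squared_eq)
  have ball: "y \<in> cball 0 (sin \<theta>) \<longleftrightarrow> (cos \<theta>)\<^sup>2 \<le> 1 - (norm y)\<^sup>2" for y :: "real^'n"
  proof -
    have "norm y \<le> sin \<theta> \<longleftrightarrow> (norm y)\<^sup>2 \<le> (sin \<theta>)\<^sup>2"
      using s by (simp add: abs_le_square_iff[symmetric])
    then show ?thesis using sc by auto
  qed
  have cap: "(y, t) \<in> cap 1 \<theta> 0 \<longleftrightarrow> 0 \<le> t \<and> (t + cos \<theta>)\<^sup>2 = 1 - (norm y)\<^sup>2" for y :: "real^'n" and t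
  proof -
    have "norm (y, t + cos \<theta>) = 1 \<longleftrightarrow> (norm y)\<^sup>2 + (t + cos \<theta>)\<^sup>2 = 1"
      by (simp add: norm_Pair)
    then show ?thesis
      by (auto simp: cap_def closed_halfspace_def e_vec_def)
  qed
  show ?thesis
  proof (intro equalityI subsetI)
    fix x :: "'n amb" assume "x \<in> cap_param \<theta> ` cball 0 (sin \<theta>)"
    then obtain y :: "real^'n" where y: "y \<in> cball 0 (sin \<theta>)"
      and x: "x = (y, sqrt (1 - (norm y)\<^sup>2) - cos \<theta>)"
      by (auto simp: cap_param_def)
    have q: "(cos \<theta>)\<^sup>2 \<le> 1 - (norm y)\<^sup>2" using y ball by blast
    then have "cos \<theta> \<le> sqrt (1 - (norm y)\<^sup>2)"
      by (rule real_le_rsqrt)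
    moreover have "0 \<le> 1 - (norm y)\<^sup>2" using q zero_le_power2 order_trans by blast
    ultimately show "x \<in> cap 1 \<theta> 0" unfolding x cap by simp
  next
    fix x :: "'n amb" assume x: "x \<in> cap 1 \<theta> 0"
    obtain y t where yt: "x = (y, t)" by (cases x)
    have t: "0 \<le> t" "(t + cos \<theta>)\<^sup>2 = 1 - (norm y)\<^sup>2" using x unfolding yt cap by auto
    have "(cos \<theta>)\<^sup>2 \<le> (t + cos \<theta>)\<^sup>2" using t c by (intro power_mono) auto
    then have "y \<in> cball 0 (sin \<theta>)" using t ball by simp
    moreover have "sqrt (1 - (norm y)\<^sup>2) = t + cos \<theta>"
      using t c by (intro real_sqrt_unique) auto
    ultimately show "x \<in> cap_param \<theta> ` cball 0 (sin \<theta>)"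
      unfolding yt cap_param_def by (intro image_eqI[where x = y]) auto
  qed
qed

definition cap_area :: "real \<Rightarrow> 'n::finite amb measure" where
  "cap_area \<theta> = area_measure (cap_param \<theta>) (cball 0 (sin \<theta>))"

definition cap_ell :: "real \<Rightarrow> 'n::finite amb \<Rightarrow> real" where
  "cap_ell \<theta> \<xi> = (sin \<theta>)\<^sup>2 + cos \<theta> * (\<xi> \<bullet> e_vec)"

definition cap_support :: "real \<Rightarrow> 'n::finite amb set \<Rightarrow> 'n amb \<Rightarrow> 'n amb \<Rightarrow> real" where
  "cap_support \<theta> S z \<xi> = inverse (cap_ell \<theta> \<xi>) * (SUP X\<in>S. (\<xi> - cos \<theta> *\<^sub>R e_vec) \<bullet> (X - z))"

definition cap_omega :: "'n::finite itself \<Rightarrow> real \<Rightarrow> real" where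
  "cap_omega _ \<theta> =
     measure (cap_area \<theta>) (cap 1 \<theta> (0 :: 'n amb)) -
     cos \<theta> * measure lborel {y. (y, 0) \<in> flat_part (enclosed (cap 1 \<theta> (0 :: 'n amb)))}"

text \<open>The entropy of \<open>enclosed S\<close>; the argument is \<open>S\<close> because the support function refers to it.\<close>

definition cap_entropy :: "real \<Rightarrow> 'n::finite amb set \<Rightarrow> real" where
  "cap_entropy \<theta> S =
     (SUP z \<in> top_of_set bdry_plane interior_of flat_part (enclosed S).
        1 / cap_omega TYPE('n) \<theta> *
        (LINT \<xi>:cap 1 \<theta> 0|cap_area \<theta>. ln (cap_support \<theta> S z \<xi>) * cap_ell \<theta> \<xi>))"

end

theory Submission
  imports Defs
begin

text \<open>
  Write \<open>K\<close> for the enclosed convex body, \<open>F\<close> for its flat part, regarded as a subset of \<open>real^'n\<close>, and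
  \<open>D\<close> for the diameter of \<open>F\<close>. Everything is compared with \<open>D\<close>.

  The geometric input is the contact angle. The normal at a rim point of \<open>F\<close> supports \<open>K\<close> and has the
  fixed positive vertical component \<open>cos \<theta>\<close>, so \<open>K\<close> leans inwards over its whole rim: the vertical projection
  maps \<open>K\<close> into \<open>F\<close> (\<open>projection_in_K\<close>), and below a point of height \<open>h\<close> the flat part contains a
  disc of radius \<open>h cot \<theta>\<close> (\<open>shadow_ball\<close>). The first fact fails without the angle condition, since an
  oblique thin cylinder would then be allowed. Two consequences follow.
  The height of \<open>K\<close> is at most \<open>D tan \<theta>\<close>, so that a cap of radius comparable to \<open>D\<close> contains \<open>K\<close>
  (\<open>outer_radius_le\<close>). If \<open>h\<close> is the maximal height, then \<open>K\<close> contains a circular cone of height \<open>h\<close> and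
  base radius \<open>h cot \<theta>\<close>, hence a cap of radius comparable to \<open>h\<close> (\<open>inner_radius_ge\<close>), while the volume of \<open>K\<close> is
  at most \<open>(2 D)^n h\<close> (\<open>volume_le\<close>).

  It remains to bound \<open>D\<close> by a multiple of \<open>exp\<close> of the entropy (\<open>width_le_exp_entropy\<close>).
  Let \<open>a\<close> and \<open>b\<close> be points of \<open>F\<close> at distance \<open>D\<close>, and let \<open>d\<close> be the unit vector along \<open>a - b\<close>. Seen from
  the midpoint of \<open>a\<close> and \<open>b\<close>, moved half-way towards an interior point of \<open>F\<close>, the support function in the direction
  belonging to \<open>\<xi>\<close> is at least \<open>D/4\<close> times the absolute value of \<open>\<xi> \<bullet> d\<close>. The logarithm of that absolute
  value is integrable over the cap, with a bound that does not depend on \<open>d\<close>, because the slab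
  where it is at most \<open>s\<close> has area \<open>O(s)\<close> (\<open>cap_slab_measure_le\<close>). As the weight \<open>cap_ell\<close> has total mass
  \<open>cap_omega\<close> (\<open>integral_ell\<close>), the entropy is at least \<open>ln D\<close> minus a constant.
\<close>

section \<open>The enclosed region and the caps\<close>

text \<open>
  A ray is connected and unbounded, so a point from which some ray escapes lies in an unbounded component.
\<close>

lemma not_inside_if_ray_avoids:
  fixes x v :: "'a::real_normed_vector"
  assumes "v \<noteq> 0" and ray: "\<And>s. 0 \<le> s \<Longrightarrow> x + s *\<^sub>R v \<notin> T"
  shows "x \<notin> inside T"
proof
  assume x: "x \<in> inside T"
  define R where "R = (\<lambda>s. x + s *\<^sub>R v) ` {0..}"
  have "connected R"
    unfolding R_def by (intro connected_continuous_image continuous_intros) auto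
  moreover have "x \<in> R" unfolding R_def by (rule image_eqI[where x = 0]) auto
  moreover have "R \<subseteq> - T" using ray by (auto simp: R_def)
  ultimately have "R \<subseteq> connected_component_set (- T) x"
    by (intro connected_component_maximal)
  then have "bounded R" using x bounded_subset by (auto simp: inside_def)
  then obtain B where B: "\<And>y. y \<in> R \<Longrightarrow> norm y \<le> B" by (auto simp: bounded_iff)
  \<comment> \<open>far enough along the ray to leave the ball of radius \<open>B\<close>\<close>
  define s where "s = (B + norm x + 1) / norm v"
  have "0 \<le> B" using B[OF \<open>x \<in> R\<close>] norm_ge_zero order_trans by blast
  then have s: "0 \<le> s" unfolding s_def by (simp add: add_nonneg_nonneg)
  then have "norm (x + s *\<^sub>R v) \<le> B" by (intro B) (auto simp: R_def)
  moreover have "norm (s *\<^sub>R v) = B + norm x + 1"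
    using \<open>v \<noteq> 0\<close> \<open>0 \<le> B\<close> by (simp add: s_def add_nonneg_nonneg)
  moreover have "norm (s *\<^sub>R v) \<le> norm (x + s *\<^sub>R v) + norm x"
    by (metis add_diff_cancel_left' norm_triangle_ineq4)
  ultimately show False by linarith
qed

lemma snd_pos_if_inside:
  assumes "S \<subseteq> closed_halfspace" and "x \<in> inside (S \<union> bdry_plane)"
  shows "0 < snd x"
proof (rule ccontr)
  assume "\<not> 0 < snd x"
  moreover have "x \<notin> S \<union> bdry_plane" using assms(2) inside_no_overlap by blast
  ultimately have n: "snd x < 0" by (auto simp: bdry_plane_def)
  have "x + s *\<^sub>R (0, -1) \<notin> S \<union> bdry_plane" if "0 \<le> s" for s
    using n that assms(1) by (auto simp: bdry_plane_def closed_halfspace_def)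
  from not_inside_if_ray_avoids[OF _ this] assms(2) show False
    by (simp add: zero_prod_def)
qed

text \<open>
  Above the plane the norm increases along the upward vertical ray, so a point outside a ball that
  contains \<open>S\<close> escapes upwards.
\<close>

lemma norm_le_if_inside:
  fixes S :: "'n::finite amb set"
  assumes S: "S \<subseteq> closed_halfspace" "S \<subseteq> cball 0 R" and x: "x \<in> inside (S \<union> bdry_plane)"
  shows "norm x \<le> R"
proof (rule ccontr)
  assume n: "\<not> norm x \<le> R"
  have p: "0 < snd x" by (rule snd_pos_if_inside[OF S(1) x])
  have "x + s *\<^sub>R (0, 1) \<notin> S \<union> bdry_plane" if "0 \<le> s" for s
  proof -
    have "(norm x)\<^sup>2 \<le> (norm (x + s *\<^sub>R (0, 1)))\<^sup>2"
      using p that by (cases x) (simp add: norm_Pair power2_sum)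
    then have "norm x \<le> norm (x + s *\<^sub>R (0, 1))"
      by (rule power2_le_imp_le) simp
    then have "x + s *\<^sub>R (0, 1) \<notin> S" using n S(2) by (meson le_less_trans mem_cball_0 not_le subsetD)
    moreover have "x + s *\<^sub>R (0, 1) \<notin> bdry_plane" using p that by (simp add: bdry_plane_def)
    ultimately show ?thesis by simp
  qed
  from not_inside_if_ray_avoids[OF _ this] x show False by (simp add: zero_prod_def)
qed

lemma closed_bdry_plane: "closed (bdry_plane :: 'n::finite amb set)"
  unfolding bdry_plane_def by (intro closed_Collect_eq continuous_intros)

lemma open_upper: "open {x :: 'n::finite amb. 0 < snd x}"
  by (intro open_Collect_less continuous_intros)

lemma closed_closed_halfspace: "closed (closed_halfspace :: 'n::finite amb set)"
  unfolding closed_halfspace_def by (intro closed_Collect_le continuous_intros)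

lemma convex_closed_halfspace: "convex (closed_halfspace :: 'n::finite amb set)"
  by (auto simp: closed_halfspace_def convex_def)

lemma
  fixes S :: "'n::finite amb set"
  assumes S: "S \<subseteq> closed_halfspace" "compact S"
  shows compact_enclosed: "compact (enclosed S)"
    and enclosed_subset_halfspace: "enclosed S \<subseteq> closed_halfspace"
    and frontier_enclosed: "frontier (enclosed S) \<subseteq> S \<union> bdry_plane"
    and interior_enclosed_nonempty: "enclosed S \<noteq> {} \<Longrightarrow> interior (enclosed S) \<noteq> {}"
proof -
  have cl: "closed (S \<union> bdry_plane)" using S closed_bdry_plane by (auto intro: compact_imp_closed)
  have op: "open (inside (S \<union> bdry_plane))" by (rule open_inside[OF cl])
  obtain R where R: "S \<subseteq> cball 0 R" using compact_imp_bounded[OF S(2)] by (metis bounded_iff mem_cball_0 subsetI)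
  have "inside (S \<union> bdry_plane) \<subseteq> cball 0 R"
    by (intro subsetI) (simp add: norm_le_if_inside[OF S(1) R])
  then show "compact (enclosed S)"
    unfolding enclosed_def compact_closure by (rule bounded_subset[OF bounded_cball])
  have "inside (S \<union> bdry_plane) \<subseteq> closed_halfspace"
    by (intro subsetI) (simp add: closed_halfspace_def less_imp_le[OF snd_pos_if_inside[OF S(1)]])
  then show "enclosed S \<subseteq> closed_halfspace"
    unfolding enclosed_def using closed_closed_halfspace by (rule closure_minimal)
  show "frontier (enclosed S) \<subseteq> S \<union> bdry_plane"
  proof -
    have "frontier (enclosed S) \<subseteq> frontier (inside (S \<union> bdry_plane))"
      unfolding enclosed_def frontier_def closure_closure
      by (intro Diff_mono order_refl interior_mono closure_subset)
    then show ?thesis using frontier_inside_subset[OF cl] by (rule order_trans)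
  qed
  show "interior (enclosed S) \<noteq> {}" if "enclosed S \<noteq> {}"
  proof -
    have "inside (S \<union> bdry_plane) \<subseteq> interior (enclosed S)"
      unfolding enclosed_def by (rule interior_maximal[OF closure_subset op])
    moreover have "inside (S \<union> bdry_plane) \<noteq> {}" using that by (auto simp: enclosed_def)
    ultimately show ?thesis by blast
  qed
qed

text \<open>
  The open region between cap and plane has its frontier in their union, so it is a union of bounded components; every
  other point escapes vertically, since the centre of the sphere lies below the plane.
\<close>

lemma enclosed_cap:
  fixes x0 :: "'n::finite amb"
  assumes \<theta>: "0 < \<theta>" "\<theta> < pi / 2" and r: "0 < r" and x0: "x0 \<in> bdry_plane"
  shows "enclosed (cap r \<theta> x0) = closed_halfspace \<inter> cball (x0 + (r * cos \<theta>) *\<^sub>R e_vec) r"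
proof -
  define c where "c = x0 + (r * cos \<theta>) *\<^sub>R (e_vec :: 'n amb)"
  define T where "T = cap r \<theta> x0 \<union> bdry_plane"
  define B0 where "B0 = {x :: 'n amb. 0 < snd x} \<inter> ball c r"
  have c: "0 < cos \<theta>" using \<theta> by (intro cos_gt_zero) auto
  have c1: "cos \<theta> < 1" using cos_monotone_0_pi[of 0 \<theta>] \<theta> by simp
  have sc: "snd c = - r * cos \<theta>" using x0 by (simp add: c_def e_vec_def bdry_plane_def)
  have capc: "cap r \<theta> x0 = closed_halfspace \<inter> sphere c r"
    by (auto simp: cap_def c_def dist_norm norm_minus_commute)
  have op: "open B0" unfolding B0_def by (intro open_Int open_upper open_ball)
  have "inside T = B0"
  proof (intro equalityI subsetI)
    fix x assume x: "x \<in> inside T"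
    have p: "0 < snd x" by (rule snd_pos_if_inside[of "cap r \<theta> x0"]) (use x in \<open>auto simp: cap_def T_def\<close>)
    show "x \<in> B0"
    proof (rule ccontr)
      assume "x \<notin> B0"
      then have "r \<le> dist c x" using p by (auto simp: B0_def)
      moreover have "x \<notin> T" using x inside_no_overlap by blast
      ultimately have far: "r < dist c x" using p by (force simp: T_def capc closed_halfspace_def)
      have "x + s *\<^sub>R (0, 1) \<notin> T" if s: "0 \<le> s" for s
      proof -
        have "0 \<le> snd (x - c)" using p sc c r by simp
        then have "(norm (x - c))\<^sup>2 \<le> (norm ((x - c) + s *\<^sub>R (0, 1)))\<^sup>2"
          using s by (cases "x - c") (simp add: norm_Pair power2_sum)
        then have "norm (x - c) \<le> norm ((x - c) + s *\<^sub>R (0, 1))"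
          by (rule power2_le_imp_le) simp
        then have "r < dist c (x + s *\<^sub>R (0, 1))"
          using far by (simp add: dist_norm norm_minus_commute algebra_simps)
        then show ?thesis using p s by (auto simp: T_def capc bdry_plane_def)
      qed
      from not_inside_if_ray_avoids[OF _ this] x show False by (simp add: zero_prod_def)
    qed
  next
    fix x assume x: "x \<in> B0"
    define Q where "Q = connected_component_set (- T) x"
    have xT: "x \<notin> T" using x by (auto simp: B0_def T_def capc bdry_plane_def)
    have "frontier B0 \<subseteq> T"
    proof
      fix y assume y: "y \<in> frontier B0"
      have "closure B0 \<subseteq> closed_halfspace \<inter> cball c r"
        by (rule closure_minimal) (auto simp: B0_def closed_halfspace_def intro!: closed_Int closed_closed_halfspace[unfolded closed_halfspace_def])
      with y have "y \<in> closed_halfspace \<inter> cball c r" "y \<notin> B0"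
        using op by (auto simp: frontier_def interior_open)
      then show "y \<in> T"
        by (auto simp: B0_def T_def capc closed_halfspace_def bdry_plane_def)
    qed
    moreover have "Q \<inter> T = {}" using connected_component_subset[of "- T" x] by (auto simp: Q_def)
    moreover have "connected Q" "x \<in> Q" using xT by (auto simp: Q_def)
    ultimately have "Q \<subseteq> B0" using connected_Int_frontier[of Q B0] x by blast
    then have "bounded Q" unfolding B0_def by (meson bounded_ball bounded_subset inf.boundedE)
    then show "x \<in> inside T" using xT by (simp add: inside_def Q_def)
  qed
  moreover have "closure B0 = closed_halfspace \<inter> cball c r"
  proof -
    have hs: "closed_halfspace = {x :: 'n amb. (0, 1) \<bullet> x \<ge> 0}"
      by (auto simp: closed_halfspace_def inner_prod_def)
    have int: "interior (closed_halfspace \<inter> cball c r) = B0"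
      unfolding hs interior_Int
      by (subst interior_halfspace_ge) (auto simp: zero_prod_def B0_def inner_prod_def)
    \<comment> \<open>half-way up the cap: a witness that the region has interior points\<close>
    define q where "q = x0 + (r * (1 - cos \<theta>) / 2) *\<^sub>R ((0, 1) :: 'n amb)"
    have "q - c = (r * (1 + cos \<theta>) / 2) *\<^sub>R (0, 1)"
      by (simp add: q_def c_def e_vec_def algebra_simps) (simp add: field_simps add_divide_distrib[symmetric])
    moreover have "dist c q = norm (q - c)" by (simp add: dist_norm norm_minus_commute)
    ultimately have "dist c q = r * (1 + cos \<theta>) / 2"
      using r c c1 by (simp add: norm_Pair)
    moreover have "snd q = r * (1 - cos \<theta>) / 2" using x0 by (simp add: q_def bdry_plane_def)
    moreover have "0 < r * (1 - cos \<theta>)" "r * (1 + cos \<theta>) < r * 2"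
      using r c1 by (auto intro: mult_strict_left_mono)
    ultimately have "q \<in> B0" by (simp add: B0_def)
    then have "closure (interior (closed_halfspace \<inter> cball c r)) = closure (closed_halfspace \<inter> cball c r)"
      using int by (intro convex_closure_interior convex_Int convex_closed_halfspace) auto
    then show ?thesis
      using int closed_closed_halfspace by (metis closed_Int closed_cball closure_closed)
  qed
  ultimately show ?thesis by (simp add: enclosed_def T_def c_def)
qed


section \<open>The area measure of the unit cap\<close>

text \<open>
  An orthogonal matrix that takes a coordinate axis to the line of \<open>y\<close> diagonalizes the matrix.
\<close>

lemma det_identity_plus_rank_one:
  fixes y :: "real^'n::finite"
  shows "det (\<chi> i j. (if i = j then 1 else 0) + c * (y $ i * y $ j)) = 1 + c * (norm y)\<^sup>2"
proof -
  obtain k :: 'n where True by blast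
  define a where "a = (if y = 0 then axis k 1 else (1 / norm y) *\<^sub>R y)"
  have "norm a = 1" and ya: "y = norm y *\<^sub>R a" by (auto simp: a_def)
  then obtain A where A: "orthogonal_matrix A" "A *v axis k 1 = a"
    using orthogonal_matrix_exists_basis by metis
  have Ak: "A $ i $ k = a $ i" for i
    using A(2) by (metis column_def matrix_vector_mul_component matrix_vector_mult_basis vec_lambda_beta)
  define D :: "real^'n^'n" where
    "D = (\<chi> i j. if i = j then (if i = k then 1 + c * (norm y)\<^sup>2 else 1) else 0)"
  have AAt: "A ** transpose A = mat 1" using A(1) by (simp add: orthogonal_matrix_def)
  have orth: "(\<Sum>l\<in>UNIV. A $ i $ l * A $ j $ l) = (if i = j then 1 else 0)" for i j
    using arg_cong[OF AAt, of "\<lambda>M. M $ i $ j"] by (simp add: matrix_matrix_mult_def transpose_def mat_def)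
  have AD: "(A ** D) $ i $ l = A $ i $ l + (if l = k then A $ i $ k * (c * (norm y)\<^sup>2) else 0)" for i l
    by (simp add: matrix_matrix_mult_def D_def if_distrib[of "\<lambda>x. _ * x"] cong: if_cong) (simp add: algebra_simps)
  have "(A ** D ** transpose A) $ i $ j = (if i = j then 1 else 0) + c * (y $ i * y $ j)" for i j
  proof -
    have "(A ** D ** transpose A) $ i $ j = (\<Sum>l\<in>UNIV. (A ** D) $ i $ l * A $ j $ l)"
      by (simp add: matrix_matrix_mult_def[of "A ** D"] transpose_def)
    also have "\<dots> = (\<Sum>l\<in>UNIV. A $ i $ l * A $ j $ l)
        + (\<Sum>l\<in>UNIV. if l = k then A $ i $ k * (c * (norm y)\<^sup>2) * A $ j $ l else 0)"
      unfolding AD sum.distrib[symmetric] by (intro sum.cong) (auto simp: algebra_simps)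
    also have "\<dots> = (if i = j then 1 else 0) + a $ i * (c * (norm y)\<^sup>2) * a $ j"
      by (simp add: orth Ak)
    also have "a $ i * (c * (norm y)\<^sup>2) * a $ j = c * (y $ i * y $ j)"
    proof -
      have "y $ i = norm y * a $ i" for i using ya by (metis vector_scaleR_component real_scaleR_def)
      from this[of i] this[of j] show ?thesis by (simp add: power2_eq_square)
    qed
    finally show ?thesis .
  qed
  then have "(\<chi> i j. (if i = j then 1 else 0) + c * (y $ i * y $ j)) = A ** D ** transpose A"
    by (simp add: vec_eq_iff)
  also have "det \<dots> = det D * (det A * det A)"
    by (simp add: det_mul det_transpose)
  also have "det A * det A = 1"
    using arg_cong[OF AAt, of det] by (simp add: det_mul det_transpose)
  also have "det D = (\<Prod>i\<in>UNIV. D $ i $ i)" by (rule det_diagonal) (simp add: D_def)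
  also have "\<dots> = 1 + c * (norm y)\<^sup>2" by (simp add: D_def)
  finally show ?thesis by simp
qed

text \<open>
  Packing: about \<open>1 / (3 s)\<close> translates of the slab by multiples of \<open>3 s d\<close> are disjoint and still fit in the ball of
  radius 2.
\<close>

lemma slab_measure_le:
  fixes d :: "'a::euclidean_space"
  assumes d: "norm d = 1" and s: "0 < s" "s \<le> 1"
  shows "measure lborel {y \<in> cball 0 1. \<bar>y \<bullet> d\<bar> \<le> s} \<le> 3 * s * measure lborel (cball (0::'a) 2)"
proof -
  define A where "A = {y \<in> cball 0 1. \<bar>y \<bullet> d\<bar> \<le> s}"
  have Acl: "closed A"
  proof -
    have "A = cball 0 1 \<inter> {y. \<bar>y \<bullet> d\<bar> \<le> s}" by (auto simp: A_def)
    then show ?thesis by (auto intro!: closed_Int closed_Collect_le continuous_intros)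
  qed
  have "bounded A" by (rule bounded_subset[OF bounded_cball, of _ 0 1]) (auto simp: A_def)
  then have "compact A" using Acl by (simp add: compact_eq_bounded_closed)
  then have Am: "A \<in> lmeasurable" by (rule lmeasurable_compact)
  \<comment> \<open>one translate more than fits, so that \<open>N\<close> is at least \<open>1 / (3 s)\<close>\<close>
  define N where "N = nat \<lfloor>1 / (3 * s)\<rfloor> + 1"
  define F where "F j = (+) ((3 * s * real j) *\<^sub>R d) ` A" for j
  have dd: "d \<bullet> d = 1" using d by (simp add: dot_square_norm)
  have Fm: "F j \<in> lmeasurable" for j unfolding F_def by (rule measurable_translation[OF Am])
  have loc: "\<bar>x \<bullet> d - 3 * s * real j\<bar> \<le> s" if x: "x \<in> F j" for x j
    using x dd by (auto simp: F_def A_def inner_add_left)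
  have "pairwise (\<lambda>i j. disjnt (F i) (F j)) {..<N}"
  proof (intro pairwiseI, unfold disjnt_iff, intro allI notI)
    fix i j x assume ij: "i \<noteq> (j::nat)" and x: "x \<in> F i \<and> x \<in> F j"
    have "\<bar>3 * s * real i - 3 * s * real j\<bar> \<le> 2 * s" using loc[of x i] loc[of x j] x by linarith
    moreover have "3 * s * real i - 3 * s * real j = 3 * s * (real i - real j)" by (simp add: algebra_simps)
    ultimately have "3 * s * \<bar>real i - real j\<bar> \<le> 2 * s" using s by (simp add: abs_mult)
    moreover have "3 * s * 1 \<le> 3 * s * \<bar>real i - real j\<bar>" using ij s by (intro mult_left_mono) auto
    ultimately show False using s by linarith
  qed
  then have "measure lebesgue (\<Union>j\<in>{..<N}. F j) = (\<Sum>j\<in>{..<N}. measure lebesgue (F j))"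
    by (intro measure_UNION' Fm) auto
  also have "\<dots> = real N * measure lebesgue A" by (simp add: F_def measure_translation)
  finally have "real N * measure lebesgue A = measure lebesgue (\<Union>j\<in>{..<N}. F j)" by simp
  also have "\<dots> \<le> measure lebesgue (cball (0::'a) 2)"
  proof (rule measure_mono_fmeasurable)
    show "(\<Union>j\<in>{..<N}. F j) \<subseteq> cball 0 2"
    proof
      fix x assume "x \<in> (\<Union>j\<in>{..<N}. F j)"
      then obtain j y where j: "j < N" and y: "y \<in> A" "x = (3 * s * real j) *\<^sub>R d + y" by (auto simp: F_def)
      have "real j \<le> 1 / (3 * s)"
      proof -
        have "j \<le> nat \<lfloor>1 / (3 * s)\<rfloor>" using j by (simp add: N_def)
        then have "real j \<le> real (nat \<lfloor>1 / (3 * s)\<rfloor>)" by (simp only: of_nat_le_iff)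
        also have "\<dots> = of_int \<lfloor>1 / (3 * s)\<rfloor>" using s by simp
        also have "\<dots> \<le> 1 / (3 * s)" by simp
        finally show ?thesis .
      qed
      then have "3 * s * real j \<le> 1" using s by (simp add: le_divide_eq mult.commute)
      then have "norm ((3 * s * real j) *\<^sub>R d) \<le> 1" using s d by simp
      then show "x \<in> cball 0 2"
        using y norm_triangle_ineq[of "(3 * s * real j) *\<^sub>R d" y] by (auto simp: A_def)
    qed
    show "(\<Union>j\<in>{..<N}. F j) \<in> sets lebesgue" using Fm by (intro sets.finite_UN) auto
  qed auto
  finally have le: "real N * measure lebesgue A \<le> measure lebesgue (cball (0::'a) 2)" .
  have "1 / (3 * s) \<le> real N" unfolding N_def by linarith
  then have "1 \<le> 3 * s * real N" using s by (simp add: divide_le_eq mult.commute)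
  then have "1 * measure lebesgue A \<le> 3 * s * real N * measure lebesgue A" by (intro mult_right_mono) auto
  also have "\<dots> \<le> 3 * s * measure lebesgue (cball (0::'a) 2)"
    using le s by (simp add: mult.assoc)
  finally show ?thesis using Acl unfolding A_def[symmetric] by simp
qed



locale acute_angle =
  fixes \<theta> :: real
  assumes \<theta>: "0 < \<theta>" "\<theta> < pi / 2"
begin

lemma cos_pos: "0 < cos \<theta>" using \<theta> by (intro cos_gt_zero) auto
lemma cos_lt_1: "cos \<theta> < 1" using cos_monotone_0_pi[of 0 \<theta>] \<theta> by simp
lemma sin_pos: "0 < sin \<theta>" using \<theta> by (intro sin_gt_zero) auto

text \<open>
  The vertical coordinate of the unit normal of the cap above \<open>y\<close>; the area density is its reciprocal.
\<close>

definition height :: "real^'n::finite \<Rightarrow> real" where "height y = sqrt (1 - (norm y)\<^sup>2)"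

lemma height_ge: "y \<in> cball 0 (sin \<theta>) \<Longrightarrow> cos \<theta> \<le> height y"
proof -
  assume "y \<in> cball 0 (sin \<theta>)"
  then have "(norm y)\<^sup>2 \<le> (sin \<theta>)\<^sup>2" by (intro power_mono) auto
  then show ?thesis unfolding height_def by (intro real_le_rsqrt) (simp add: sin_squared_eq)
qed

lemma height_pos: "y \<in> cball 0 (sin \<theta>) \<Longrightarrow> 0 < height y"
  using height_ge cos_pos by (meson less_le_trans)

lemma inverse_height_bounds:
  assumes "y \<in> cball 0 (sin \<theta>)"
  shows "0 \<le> 1 / height y" "1 / height y \<le> 1 / cos \<theta>"
  using height_pos[OF assms] height_ge[OF assms] cos_pos by (auto intro: divide_left_mono)

lemma height_le_1: "height y \<le> 1" by (simp add: height_def)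

text \<open>
  The cap is the graph of \<open>height\<close> up to a constant, so its Gram matrix is the identity plus a rank-one
  matrix built from the gradient of \<open>height\<close>.
\<close>

lemma sqrt_det_gram:
  fixes y :: "real^'n::finite"
  assumes y: "y \<in> cball 0 (sin \<theta>)"
  shows "sqrt (det (gram_matrix (cap_param \<theta>) y)) = 1 / height y"
proof -
  have hp: "0 < height y" by (rule height_pos[OF y])
  then have pos: "0 < 1 - (norm y)\<^sup>2" by (simp add: height_def)
  have h2: "(height y)\<^sup>2 = 1 - (norm y)\<^sup>2" using pos by (simp add: height_def)
  have pos': "0 < 1 - y \<bullet> y" using pos by (simp add: power2_norm_eq_inner)
  have h: "height y = sqrt (1 - y \<bullet> y)" by (simp add: height_def power2_norm_eq_inner)
  have "((\<lambda>y. 1 - y \<bullet> y) has_derivative (\<lambda>v. - (2 * (y \<bullet> v)))) (at y)"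
    by (auto intro!: derivative_eq_intros simp: inner_commute)
  moreover have "(sqrt has_derivative (\<lambda>t. inverse (sqrt (1 - y \<bullet> y)) / 2 * t)) (at (1 - y \<bullet> y))"
    using DERIV_real_sqrt[OF pos'] unfolding has_field_derivative_def .
  ultimately have "((\<lambda>y. sqrt (1 - y \<bullet> y)) has_derivative
      (\<lambda>v. inverse (sqrt (1 - y \<bullet> y)) / 2 * - (2 * (y \<bullet> v)))) (at y)"
    by (rule has_derivative_compose)
  also have "(\<lambda>v. inverse (sqrt (1 - y \<bullet> y)) / 2 * - (2 * (y \<bullet> v))) = (\<lambda>v. - (y \<bullet> v) / height y)"
    by (simp add: h field_simps)
  finally have "((\<lambda>y. sqrt (1 - y \<bullet> y) - cos \<theta>) has_derivative (\<lambda>v. - (y \<bullet> v) / height y)) (at y)"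
    using has_derivative_diff[OF _ has_derivative_const[of "cos \<theta>"]] by fastforce
  then have "(cap_param \<theta> has_derivative (\<lambda>v. (v, - (y \<bullet> v) / height y))) (at y)"
    unfolding cap_param_def[abs_def] power2_norm_eq_inner
    by (intro has_derivative_Pair has_derivative_ident)
  then have fd: "frechet_derivative (cap_param \<theta>) (at y) = (\<lambda>v. (v, - (y \<bullet> v) / height y))"
    by (rule frechet_derivative_at[symmetric])
  have ax: "axis i (1::real) $ j = (if i = j then 1 else 0)" for i j :: 'n by (auto simp: axis_def)
  have "gram_matrix (cap_param \<theta>) y = (\<chi> i j. (if i = j then 1 else 0) + (1 / (height y)\<^sup>2) * (y $ i * y $ j))"
    unfolding gram_matrix_def fd
    by (simp add: vec_eq_iff inner_prod_def inner_axis_axis inner_axis power2_eq_square ax)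
  then have "det (gram_matrix (cap_param \<theta>) y) = 1 + (1 / (height y)\<^sup>2) * (norm y)\<^sup>2"
    by (simp only: det_identity_plus_rank_one)
  also have "\<dots> = (1 / height y)\<^sup>2"
    using hp h2 by (simp add: field_simps)
  finally show ?thesis using hp by simp
qed

lemma height_measurable[measurable]: "height \<in> borel_measurable borel"
  unfolding height_def[abs_def] by measurable

lemma cap_param_measurable[measurable]: "cap_param \<theta> \<in> borel_measurable borel"
  unfolding cap_param_def[abs_def] by (intro borel_measurable_continuous_onI continuous_intros)

lemma cap_param_measurable_lborel: "cap_param \<theta> \<in> borel_measurable lborel"
  by simp

lemma cap_area_eq:
  "(cap_area \<theta> :: 'n::finite amb measure) = distr (density (restrict_space lborel (cball 0 (sin \<theta>))) (\<lambda>y. ennreal (1 / height y))) borel (cap_param \<theta>)"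
proof -
  let ?R = "restrict_space lborel (cball (0::real^'n) (sin \<theta>))"
  have sp: "space ?R = cball 0 (sin \<theta>)" by (simp add: space_restrict_space)
  have m: "(\<lambda>y. ennreal (1 / height y)) \<in> borel_measurable ?R"
    by (intro measurable_restrict_space1) measurable
  have eq: "ennreal (sqrt (det (gram_matrix (cap_param \<theta>) y))) = ennreal (1 / height y)" if "y \<in> space ?R" for y
    using that unfolding sp by (simp only: sqrt_det_gram)
  have m': "(\<lambda>y. ennreal (sqrt (det (gram_matrix (cap_param \<theta>) y)))) \<in> borel_measurable ?R"
    using m eq by (subst measurable_cong) auto
  have "density ?R (\<lambda>y. ennreal (sqrt (det (gram_matrix (cap_param \<theta>) y)))) = density ?R (\<lambda>y. ennreal (1 / height y))"
    using m m' by (intro density_cong AE_I2 eq) auto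
  then show ?thesis by (simp add: cap_area_def area_measure_def)
qed

lemma sets_cap_area[measurable_cong]: "sets (cap_area \<theta>) = sets borel" by (simp add: cap_area_eq)
lemma space_cap_area[simp]: "space (cap_area \<theta>) = UNIV" by (simp add: cap_area_eq)

lemma emeasure_cap_area_le:
  fixes A :: "'n::finite amb set"
  assumes A: "A \<in> sets borel"
  shows "emeasure (cap_area \<theta>) A \<le> ennreal (1 / cos \<theta>) * emeasure lborel {y \<in> cball 0 (sin \<theta>). cap_param \<theta> y \<in> A}"
proof -
  let ?R = "restrict_space lborel (cball (0::real^'n) (sin \<theta>))"
  have pm: "cap_param \<theta> \<in> measurable (density ?R (\<lambda>y. ennreal (1 / height y))) borel"
    using measurable_restrict_space1[OF cap_param_measurable_lborel] by simp
  have B: "{y \<in> cball 0 (sin \<theta>). cap_param \<theta> y \<in> A} \<in> sets borel"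
  proof -
    have "cap_param \<theta> -` A \<in> sets borel" using measurable_sets[OF cap_param_measurable A] by simp
    then have "cball 0 (sin \<theta>) \<inter> cap_param \<theta> -` A \<in> sets borel" by (intro sets.Int) auto
    moreover have "{y \<in> cball 0 (sin \<theta>). cap_param \<theta> y \<in> A} = cball 0 (sin \<theta>) \<inter> cap_param \<theta> -` A" by auto
    ultimately show ?thesis by simp
  qed
  have B': "cap_param \<theta> -` A \<inter> space ?R = {y \<in> cball 0 (sin \<theta>). cap_param \<theta> y \<in> A}" by (auto simp: space_restrict_space)
  have Bs: "{y \<in> cball 0 (sin \<theta>). cap_param \<theta> y \<in> A} \<in> sets ?R"
    using B by (subst sets_restrict_space_iff) auto
  have "emeasure (cap_area \<theta>) A = emeasure (density ?R (\<lambda>y. ennreal (1 / height y))) {y \<in> cball 0 (sin \<theta>). cap_param \<theta> y \<in> A}"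
    unfolding cap_area_eq emeasure_distr[OF pm A] space_density B' ..
  also have "\<dots> = (\<integral>\<^sup>+ y. ennreal (1 / height y) * indicator {y \<in> cball 0 (sin \<theta>). cap_param \<theta> y \<in> A} y \<partial>?R)"
    using Bs by (intro emeasure_density) (auto intro!: measurable_restrict_space1)
  also have "\<dots> \<le> (\<integral>\<^sup>+ y. ennreal (1 / cos \<theta>) * indicator {y \<in> cball 0 (sin \<theta>). cap_param \<theta> y \<in> A} y \<partial>?R)"
    by (intro nn_integral_mono mult_right_mono ennreal_leI inverse_height_bounds) (simp_all add: space_restrict_space)
  also have "\<dots> = ennreal (1 / cos \<theta>) * emeasure ?R {y \<in> cball 0 (sin \<theta>). cap_param \<theta> y \<in> A}"
    using Bs by (simp add: nn_integral_cmult_indicator)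
  also have "emeasure ?R {y \<in> cball 0 (sin \<theta>). cap_param \<theta> y \<in> A} = emeasure lborel {y \<in> cball 0 (sin \<theta>). cap_param \<theta> y \<in> A}"
    by (intro emeasure_restrict_space) auto
  finally show ?thesis .
qed

lemma finite_cap_area: "finite_measure (cap_area \<theta> :: 'n::finite amb measure)"
proof (rule finite_measureI)
  have "emeasure (cap_area \<theta> :: 'n amb measure) UNIV \<le> ennreal (1 / cos \<theta>) * emeasure lborel (cball (0::real^'n) (sin \<theta>))"
    using emeasure_cap_area_le[of "UNIV :: 'n amb set"] by (simp add: cball_def)
  also have "\<dots> < \<infinity>" using emeasure_bounded_finite[of "cball (0::real^'n) (sin \<theta>)"] by (simp add: ennreal_mult_less_top)
  finally show "emeasure (cap_area \<theta> :: 'n amb measure) (space (cap_area \<theta>)) \<noteq> \<infinity>" by simp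
qed

text \<open>
  The density is at most \<open>1 / cos \<theta>\<close> on the disc below the cap.
\<close>

lemma measure_cap_area_le:
  fixes A :: "'n::finite amb set"
  assumes A: "A \<in> sets borel" and B: "B \<in> sets borel" "bounded B" "{y \<in> cball 0 (sin \<theta>). cap_param \<theta> y \<in> A} \<subseteq> B"
  shows "measure (cap_area \<theta>) A \<le> measure lborel B / cos \<theta>"
proof -
  interpret finite_measure "cap_area \<theta> :: 'n amb measure" by (rule finite_cap_area)
  have Bf: "emeasure lborel B = ennreal (measure lborel B)"
    using emeasure_bounded_finite[OF B(2)] by (intro emeasure_eq_ennreal_measure) auto
  have "ennreal (measure (cap_area \<theta>) A) = emeasure (cap_area \<theta>) A" by (simp add: emeasure_eq_measure)
  also have "\<dots> \<le> ennreal (1 / cos \<theta>) * emeasure lborel {y \<in> cball 0 (sin \<theta>). cap_param \<theta> y \<in> A}"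
    by (rule emeasure_cap_area_le[OF A])
  also have "\<dots> \<le> ennreal (1 / cos \<theta>) * emeasure lborel B"
    using B by (intro mult_left_mono emeasure_mono) auto
  also have "\<dots> = ennreal (measure lborel B / cos \<theta>)"
    unfolding Bf using cos_pos by (simp add: ennreal_mult'[symmetric])
  finally show ?thesis using cos_pos by (simp add: ennreal_le_iff)
qed

lemma cap_slab_measure_le:
  fixes d :: "real^'n::finite"
  assumes d: "norm d = 1" and s: "0 < s" "s \<le> 1"
  shows "measure (cap_area \<theta>) {\<xi> :: 'n amb. \<bar>fst \<xi> \<bullet> d\<bar> \<le> s} \<le> 3 * measure lborel (cball (0::real^'n) 2) / cos \<theta> * s"
proof -
  have "measure (cap_area \<theta>) {\<xi> :: 'n amb. \<bar>fst \<xi> \<bullet> d\<bar> \<le> s} \<le> measure lborel {y \<in> cball 0 1. \<bar>y \<bullet> d\<bar> \<le> s} / cos \<theta>"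
  proof (rule measure_cap_area_le)
    show "{\<xi> :: 'n amb. \<bar>fst \<xi> \<bullet> d\<bar> \<le> s} \<in> sets borel"
      by (intro borel_closed closed_Collect_le continuous_intros)
    have "closed (cball 0 1 \<inter> {y. \<bar>y \<bullet> d\<bar> \<le> s})"
      by (intro closed_Int closed_cball closed_Collect_le continuous_intros)
    moreover have "{y \<in> cball 0 1. \<bar>y \<bullet> d\<bar> \<le> s} = cball 0 1 \<inter> {y. \<bar>y \<bullet> d\<bar> \<le> s}" by auto
    ultimately show "{y \<in> cball 0 1. \<bar>y \<bullet> d\<bar> \<le> s} \<in> sets borel"
      by (simp add: borel_closed)
    show "bounded {y \<in> cball 0 1. \<bar>y \<bullet> d\<bar> \<le> s}" by (rule bounded_subset[OF bounded_cball, of _ 0 1]) auto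
    show "{y \<in> cball 0 (sin \<theta>). cap_param \<theta> y \<in> {\<xi>. \<bar>fst \<xi> \<bullet> d\<bar> \<le> s}} \<subseteq> {y \<in> cball 0 1. \<bar>y \<bullet> d\<bar> \<le> s}"
      using order_trans[OF _ sin_le_one, of _ \<theta>] by (auto simp: cap_param_def)
  qed
  also have "\<dots> \<le> (3 * s * measure lborel (cball (0::real^'n) 2)) / cos \<theta>"
    using slab_measure_le[OF d s] cos_pos by (intro divide_right_mono) auto
  finally show ?thesis by (simp add: algebra_simps)
qed

lemma integral_cap_area:
  fixes g :: "'n::finite amb \<Rightarrow> real"
  assumes g: "g \<in> borel_measurable borel"
  shows "(\<integral>\<xi>. g \<xi> \<partial>cap_area \<theta>) = (\<integral>y. indicator (cball 0 (sin \<theta>)) y * ((1 / height y) * g (cap_param \<theta> y)) \<partial>lborel)"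
proof -
  let ?R = "restrict_space lborel (cball (0::real^'n) (sin \<theta>))"
  have pm: "cap_param \<theta> \<in> measurable ?R borel" by (rule measurable_restrict_space1[OF cap_param_measurable_lborel])
  have gp: "(\<lambda>y. g (cap_param \<theta> y)) \<in> borel_measurable ?R" using measurable_compose[OF pm g] .
  have "(\<integral>\<xi>. g \<xi> \<partial>cap_area \<theta>) = (\<integral>y. g (cap_param \<theta> y) \<partial>density ?R (\<lambda>y. ennreal (1 / height y)))"
    unfolding cap_area_eq using pm g by (intro integral_distr) auto
  also have "\<dots> = (\<integral>y. (1 / height y) *\<^sub>R g (cap_param \<theta> y) \<partial>?R)"
  proof (rule integral_density[OF gp])
    show "AE y in ?R. 0 \<le> 1 / height y"
      by (intro AE_I2 inverse_height_bounds) (simp add: space_restrict_space)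
  qed (intro measurable_restrict_space1, measurable)
  also have "\<dots> = (\<integral>y. indicator (cball 0 (sin \<theta>)) y *\<^sub>R ((1 / height y) *\<^sub>R g (cap_param \<theta> y)) \<partial>lborel)"
    by (intro integral_restrict_space) auto
  finally show ?thesis by simp
qed

lemma closed_cap: "closed (cap 1 \<theta> (0 :: 'n::finite amb))"
proof -
  have "cap 1 \<theta> (0 :: 'n amb) = closed_halfspace \<inter> sphere (cos \<theta> *\<^sub>R e_vec) 1"
    by (auto simp: cap_def dist_norm norm_minus_commute)
  then show ?thesis by (simp add: closed_Int closed_closed_halfspace)
qed

lemma cap_param_in_cap: "y \<in> cball 0 (sin \<theta>) \<Longrightarrow> cap_param \<theta> y \<in> cap 1 \<theta> (0 :: 'n::finite amb)"
  using cap_param_image[OF \<theta>] by blast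

lemma cap_ell_param: "cap_ell \<theta> (cap_param \<theta> y) = 1 - cos \<theta> * height y"
  by (simp add: cap_ell_def cap_param_def e_vec_def inner_prod_def height_def sin_squared_eq power2_eq_square algebra_simps)

lemma cap_ell_bounds:
  fixes \<xi> :: "'n::finite amb"
  assumes "\<xi> \<in> cap 1 \<theta> 0"
  shows "1 - cos \<theta> \<le> cap_ell \<theta> \<xi>" "cap_ell \<theta> \<xi> \<le> 1" "0 < cap_ell \<theta> \<xi>"
proof -
  obtain y where y: "y \<in> cball 0 (sin \<theta>)" "\<xi> = cap_param \<theta> y" using assms cap_param_image[OF \<theta>] by blast
  have "cos \<theta> * height y \<le> cos \<theta> * 1" using height_le_1 cos_pos by (intro mult_left_mono) auto
  moreover have "0 \<le> cos \<theta> * height y" using height_pos[OF y(1)] cos_pos by simp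
  ultimately show "1 - cos \<theta> \<le> cap_ell \<theta> \<xi>" "cap_ell \<theta> \<xi> \<le> 1" "0 < cap_ell \<theta> \<xi>"
    using cos_lt_1 by (auto simp: y(2) cap_ell_param)
qed

lemma cap_ell_continuous: "continuous_on UNIV (cap_ell \<theta>)"
  unfolding cap_ell_def[abs_def] by (intro continuous_intros)

lemma flat_part_cap: "{y. (y, 0) \<in> flat_part (enclosed (cap 1 \<theta> (0 :: 'n::finite amb)))} = cball (0::real^'n) (sin \<theta>)"
proof -
  have enc: "enclosed (cap 1 \<theta> (0 :: 'n amb)) = closed_halfspace \<inter> cball (cos \<theta> *\<^sub>R e_vec) 1"
    using enclosed_cap[OF \<theta>, of 1 "0 :: 'n amb"] by (simp add: bdry_plane_def)
  have "(y, 0) \<in> cball (cos \<theta> *\<^sub>R e_vec) 1 \<longleftrightarrow> y \<in> cball 0 (sin \<theta>)" for y :: "real^'n"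
  proof -
    have "dist (cos \<theta> *\<^sub>R e_vec) (y, 0) = norm (y, cos \<theta>)"
      by (simp add: dist_norm e_vec_def norm_Pair)
    moreover have "norm (y, cos \<theta>) \<le> 1 \<longleftrightarrow> (norm y)\<^sup>2 \<le> (sin \<theta>)\<^sup>2"
      by (simp add: norm_Pair sin_squared_eq le_diff_eq)
    moreover have "(norm y)\<^sup>2 \<le> (sin \<theta>)\<^sup>2 \<longleftrightarrow> norm y \<le> sin \<theta>"
      using sin_pos by (simp add: abs_le_square_iff[symmetric])
    ultimately show ?thesis by simp
  qed
  moreover have "(y, 0) \<in> closed_halfspace" "(y, 0) \<in> bdry_plane" for y :: "real^'n"
    by (simp_all add: closed_halfspace_def bdry_plane_def)
  ultimately show ?thesis unfolding flat_part_def enc by (simp only: Int_iff set_eq_iff mem_Collect_eq simp_thms)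
qed

text \<open>
  On the disc the weight times the area density is \<open>1 / height y - cos \<theta>\<close>, whose two terms integrate to the two terms
  of \<open>cap_omega\<close>. This is what makes the entropy scale by exactly \<open>ln\<close> of the scaling factor.
\<close>

lemma integral_ell:
  "(LINT \<xi>:cap 1 \<theta> 0|cap_area \<theta>. cap_ell \<theta> (\<xi> :: 'n::finite amb)) = cap_omega TYPE('n) \<theta>"
  and cap_omega_pos: "0 < cap_omega TYPE('n::finite) \<theta>"
proof -
  let ?D = "cball (0::real^'n) (sin \<theta>)" and ?C = "cap 1 \<theta> (0 :: 'n amb)"
  have Cb: "?C \<in> sets borel" using closed_cap by (rule borel_closed)
  have em: "emeasure lborel ?D < \<infinity>" by (rule emeasure_bounded_finite) simp
  have int1: "integrable lborel (\<lambda>y. indicator ?D y * (1 / height y))"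
  proof (rule integrableI_bounded_set[of ?D _ _ "1 / cos \<theta>"])
    show "AE y in lborel. y \<in> ?D \<longrightarrow> norm (indicator ?D y * (1 / height y)) \<le> 1 / cos \<theta>"
    proof (intro AE_I2 impI)
      fix y assume y: "y \<in> ?D"
      have "norm (indicator ?D y * (1 / height y)) = 1 / height y"
        unfolding real_norm_def indicator_simps(1)[OF y] using inverse_height_bounds(1)[OF y] by (simp only: mult_1 abs_of_nonneg)
      then show "norm (indicator ?D y * (1 / height y)) \<le> 1 / cos \<theta>" using inverse_height_bounds(2)[OF y] by simp
    qed
    show "(\<lambda>y. indicator ?D y * (1 / height y)) \<in> borel_measurable lborel"
      by (intro borel_measurable_times borel_measurable_indicator borel_measurable_divide
          borel_measurable_const) (simp_all add: height_measurable)
  qed (use em in auto)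
  have int2: "integrable lborel (\<lambda>y. indicator ?D y * c)" for c :: real
    by (intro integrable_mult_left integrable_real_indicator em) simp
  have L: "(LINT \<xi>:?C|cap_area \<theta>. cap_ell \<theta> \<xi>) = (\<integral>y. indicator ?D y * (1 / height y) - indicator ?D y * cos \<theta> \<partial>lborel)"
  proof -
    have "(LINT \<xi>:?C|cap_area \<theta>. cap_ell \<theta> \<xi>) = (\<integral>y. indicator ?D y * ((1 / height y) * (indicator ?C (cap_param \<theta> y) *\<^sub>R cap_ell \<theta> (cap_param \<theta> y))) \<partial>lborel)"
      unfolding set_lebesgue_integral_def
      by (intro integral_cap_area borel_measurable_scaleR borel_measurable_indicator Cb
          borel_measurable_continuous_onI cap_ell_continuous)
    also have "\<dots> = (\<integral>y. indicator ?D y * (1 / height y) - indicator ?D y * cos \<theta> \<partial>lborel)"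
    proof (rule Bochner_Integration.integral_cong[OF refl])
      fix y :: "real^'n"
      show "indicator ?D y * ((1 / height y) * (indicator ?C (cap_param \<theta> y) *\<^sub>R cap_ell \<theta> (cap_param \<theta> y)))
        = indicator ?D y * (1 / height y) - indicator ?D y * cos \<theta>"
      proof (cases "y \<in> ?D")
        case True
        have "(1 / height y) * (1 - cos \<theta> * height y) = 1 / height y - cos \<theta>"
          using height_pos[OF True] by (simp add: right_diff_distrib)
        then show ?thesis
          by (simp only: indicator_simps(1)[OF True] indicator_simps(1)[OF cap_param_in_cap[OF True]]
              cap_ell_param scaleR_one mult_1)
      next
        case False
        show ?thesis by (simp only: indicator_simps(2)[OF False] mult_zero_left diff_self)
      qed
    qed
    finally show ?thesis .
  qed
  have "measure (cap_area \<theta>) ?C = (\<integral>\<xi>. indicator ?C \<xi> \<partial>cap_area \<theta>)" by simp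
  also have "\<dots> = (\<integral>y. indicator ?D y * ((1 / height y) * indicator ?C (cap_param \<theta> y)) \<partial>lborel)"
    by (intro integral_cap_area borel_measurable_indicator Cb)
  also have "\<dots> = (\<integral>y. indicator ?D y * (1 / height y) \<partial>lborel)"
    using cap_param_in_cap by (intro Bochner_Integration.integral_cong) (auto simp: indicator_def)
  finally have m: "measure (cap_area \<theta>) ?C = (\<integral>y. indicator ?D y * (1 / height y) \<partial>lborel)" .
  have c: "(\<integral>y. indicator ?D y * c \<partial>lborel) = c * measure lborel ?D" for c
    by simp
  show eq: "(LINT \<xi>:?C|cap_area \<theta>. cap_ell \<theta> \<xi>) = cap_omega TYPE('n) \<theta>"
    unfolding L cap_omega_def m flat_part_cap Bochner_Integration.integral_diff[OF int1 int2] c ..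
  have "0 < (1 - cos \<theta>) * measure lborel ?D"
    using cos_lt_1 sin_pos content_cball_pos[of "sin \<theta>" "0::real^'n"] by simp
  also have "\<dots> = (\<integral>y. indicator ?D y * (1 - cos \<theta>) \<partial>lborel)" by (rule c[symmetric])
  also have "\<dots> \<le> (\<integral>y. indicator ?D y * (1 / height y) - indicator ?D y * cos \<theta> \<partial>lborel)"
  proof (rule integral_mono[OF int2 Bochner_Integration.integrable_diff[OF int1 int2]])
    fix y :: "real^'n"
    show "indicator ?D y * (1 - cos \<theta>) \<le> indicator ?D y * (1 / height y) - indicator ?D y * cos \<theta>"
      using height_pos[of y] height_le_1[of y] by (auto simp: indicator_def)
  qed
  finally show "0 < cap_omega TYPE('n) \<theta>" using eq L by simp
qed

end


section \<open>Convex geometry of a capillary body\<close>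

text \<open>
  The form in which a supporting half-space constrains tangent vectors: a linear function that is nonpositive along a
  one-sided curve has nonpositive derivative at its start.
\<close>

lemma velocity_le_0:
  fixes \<gamma> :: "real \<Rightarrow> 'a::euclidean_space"
  assumes \<gamma>: "(\<gamma> has_vector_derivative d) (at_right 0)" and "0 < \<epsilon>"
    and le: "\<And>t. t \<in> {0<..<\<epsilon>} \<Longrightarrow> w \<bullet> (\<gamma> t - \<gamma> 0) \<le> 0"
  shows "w \<bullet> d \<le> 0"
proof -
  have "((\<lambda>t. w \<bullet> \<gamma> t) has_vector_derivative w \<bullet> d) (at_right 0)"
    using \<gamma> by (auto simp: has_vector_derivative_def intro!: derivative_eq_intros)
  then have "((\<lambda>t. (w \<bullet> \<gamma> t - w \<bullet> \<gamma> 0) / (t - 0)) \<longlongrightarrow> w \<bullet> d) (at_right 0)"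
    by (simp add: has_real_derivative_iff_has_vector_derivative[symmetric] has_field_derivative_iff)
  moreover have "\<forall>\<^sub>F t in at_right 0. (w \<bullet> \<gamma> t - w \<bullet> \<gamma> 0) / (t - 0) \<le> 0"
    unfolding eventually_at_right_field
    using \<open>0 < \<epsilon>\<close> le by (intro exI[of _ \<epsilon>]) (auto simp: inner_diff_right divide_le_0_iff)
  ultimately show ?thesis
    by (intro tendsto_upperbound[where F = "at_right 0"]) auto
qed

text \<open>
  A slice chart enters only through the derivative \<open>L\<close> of its inverse: \<open>L\<close> is invertible and takes every direction that stays
  in the model set to the velocity of a curve in \<open>S\<close>. The argument is the same for interior and boundary charts.
\<close>

lemma slice_chart_derivative:
  assumes "slice_chart S M p \<phi>" and "p \<in> S"
  obtains L where "linear L" "surj L" "\<phi> p \<in> M"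
    and "\<And>v. (\<And>t. 0 \<le> t \<Longrightarrow> \<phi> p + t *\<^sub>R v \<in> M) \<Longrightarrow>
      \<exists>\<gamma> \<epsilon>. 0 < \<epsilon> \<and> \<gamma> 0 = p \<and> (\<forall>t\<in>{0..<\<epsilon>}. \<gamma> t \<in> S) \<and>
        (\<gamma> has_vector_derivative L v) (at_right (0::real))"
proof -
  obtain U V \<psi> where UV: "open U" "open V" "p \<in> U" and hom: "homeomorphism U V \<phi> \<psi>"
    and sm: "smooth_on U \<phi>" "smooth_on V \<psi>" and im: "\<phi> ` (S \<inter> U) = V \<inter> M"
    using assms(1) unfolding slice_chart_def by auto
  have \<psi>\<phi>: "\<psi> (\<phi> x) = x" "\<phi> x \<in> V" if "x \<in> U" for x
    using hom that by (auto simp: homeomorphism_def)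
  have pV: "\<phi> p \<in> V" by (rule \<psi>\<phi>(2)[OF UV(3)])
  have "Ck_on (Suc 0) U \<phi>" "Ck_on (Suc 0) V \<psi>" using sm by (auto simp: smooth_on_def simp del: Ck_on.simps)
  then have "\<phi> differentiable (at p)" "\<psi> differentiable (at (\<phi> p))" using UV(3) pV by auto
  then obtain P L where P: "(\<phi> has_derivative P) (at p)" and L: "(\<psi> has_derivative L) (at (\<phi> p))"
    unfolding differentiable_def by blast
  have "(\<psi> \<circ> \<phi> has_derivative L \<circ> P) (at p)" by (rule diff_chain_at[OF P L])
  then have "((\<lambda>x. x) has_derivative L \<circ> P) (at p)"
    by (rule has_derivative_transform_within_open[OF _ UV(1,3)]) (simp add: \<psi>\<phi>)
  then have "L \<circ> P = (\<lambda>x. x)" using has_derivative_ident by (rule has_derivative_unique)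
  then have "surj L" by (metis comp_apply surjI)
  moreover have "linear L" using L by (rule has_derivative_linear)
  moreover have "\<phi> p \<in> M" using im assms(2) UV(3) by blast
  moreover have "\<exists>\<gamma> \<epsilon>. 0 < \<epsilon> \<and> \<gamma> 0 = p \<and> (\<forall>t\<in>{0..<\<epsilon>}. \<gamma> t \<in> S) \<and>
        (\<gamma> has_vector_derivative L v) (at_right (0::real))"
    if v: "\<And>t. 0 \<le> t \<Longrightarrow> \<phi> p + t *\<^sub>R v \<in> M" for v
  proof -
    obtain d where d: "0 < d" "ball (\<phi> p) d \<subseteq> V" using UV(2) pV open_contains_ball by blast
    define \<epsilon> where "\<epsilon> = d / (norm v + 1)"
    have "0 < \<epsilon>" using d by (simp add: \<epsilon>_def add_nonneg_pos)
    moreover have "\<psi> (\<phi> p + t *\<^sub>R v) \<in> S" if t: "t \<in> {0..<\<epsilon>}" for t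
    proof -
      have "norm (t *\<^sub>R v) \<le> t * (norm v + 1)" using t by (simp add: mult_left_mono)
      also have "\<dots> < d" using t by (simp add: \<epsilon>_def pos_less_divide_eq add_nonneg_pos)
      finally have "\<phi> p + t *\<^sub>R v \<in> V" using d(2) by (auto simp: dist_norm)
      then have "\<phi> p + t *\<^sub>R v \<in> \<phi> ` (S \<inter> U)" using im v t by auto
      then show ?thesis using \<psi>\<phi>(1) by auto
    qed
    moreover have "((\<lambda>t. \<psi> (\<phi> p + t *\<^sub>R v)) has_vector_derivative L v) (at_right 0)"
    proof -
      have "((\<lambda>t. \<phi> p + t *\<^sub>R v) has_vector_derivative v) (at_right 0)"
        by (auto intro!: derivative_eq_intros simp: has_vector_derivative_def)
      moreover have "(\<psi> has_derivative L) (at (\<phi> p + 0 *\<^sub>R v))" using L by simp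
      ultimately show ?thesis
        using vector_derivative_diff_chain_within[of "\<lambda>t. \<phi> p + t *\<^sub>R v" v 0 "{0<..}" \<psi> L]
        by (auto simp: o_def intro: has_derivative_at_withinI)
    qed
    ultimately show ?thesis
      using \<psi>\<phi>(1)[OF UV(3)] by (intro exI[of _ "\<lambda>t. \<psi> (\<phi> p + t *\<^sub>R v)"] exI[of _ \<epsilon>]) auto
  qed
  ultimately show ?thesis using that by blast
qed

text \<open>
  The image of the horizontal hyperplane under an invertible map is a hyperplane, which has a single normal line.
  This is how a supporting normal of the convex body is identified with the normal of the hypersurface.
\<close>

lemma normal_line_unique:
  fixes L :: "'n::finite amb \<Rightarrow> 'n amb"
  assumes L: "linear L" "surj L" and \<nu>: "\<nu> \<noteq> 0" "\<And>v. snd v = 0 \<Longrightarrow> \<nu> \<bullet> L v = 0"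
    and w: "\<And>v. snd v = 0 \<Longrightarrow> w \<bullet> L v = 0"
  shows "\<exists>c. w = c *\<^sub>R \<nu>"
proof -
  define d where "d = L (0, 1)"
  have split: "\<exists>v t. x = L v + t *\<^sub>R d \<and> snd v = 0" for x
  proof -
    obtain u where "x = L u" using L(2) by (metis surjD)
    also have "L u = L ((fst u, 0) + snd u *\<^sub>R (0, 1))" by (rule arg_cong[where f = L]) (cases u, simp)
    also have "\<dots> = L (fst u, 0) + snd u *\<^sub>R d"
      by (simp only: d_def linear_add[OF L(1)] linear_scale[OF L(1)])
    finally have "x = L (fst u, 0) + snd u *\<^sub>R d" .
    then show ?thesis by (intro exI[of _ "(fst u, 0)"] exI[of _ "snd u"]) auto
  qed
  have zero: "y = 0" if y: "\<And>v. snd v = 0 \<Longrightarrow> y \<bullet> L v = 0" "y \<bullet> d = 0" for y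
  proof -
    obtain v t where "y = L v + t *\<^sub>R d" "snd v = 0" using split by blast
    then have "y \<bullet> y = 0" using y by (simp add: inner_add_right inner_scaleR_right)
    then show ?thesis by simp
  qed
  have nd: "\<nu> \<bullet> d \<noteq> 0" using zero[OF \<nu>(2)] \<nu>(1) by blast
  have "w - ((w \<bullet> d) / (\<nu> \<bullet> d)) *\<^sub>R \<nu> = 0"
    using nd by (intro zero) (auto simp: inner_diff_left \<nu>(2) w)
  then show ?thesis by auto
qed

locale convex_capillary = acute_angle \<theta> for \<theta> :: real +
  fixes S :: "'n::finite amb set" and \<nu> :: "'n amb \<Rightarrow> 'n amb"
  assumes smooth: "smooth_hypersurface S" and compact_S: "compact S" and S_half: "S \<subseteq> closed_halfspace"
    and bdry_ne: "mfd_boundary S \<noteq> {}" and bdry_eq: "mfd_boundary S = S \<inter> bdry_plane"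
    and normal: "outward_unit_normal S \<nu>"
    and angle: "\<And>p. p \<in> S \<Longrightarrow> snd p = 0 \<Longrightarrow> snd (\<nu> p) = cos \<theta>"
    and conv: "convex (enclosed S)"
begin

abbreviation K where "K \<equiv> enclosed S"

lemmas K_compact = compact_enclosed[OF S_half compact_S]
lemmas K_half = enclosed_subset_halfspace[OF S_half compact_S]
lemmas K_frontier = frontier_enclosed[OF S_half compact_S]

lemma norm_\<nu>: "p \<in> S \<Longrightarrow> norm (\<nu> p) = 1"
  using normal by (auto simp: outward_unit_normal_def)

lemma upper_point_in_K:
  assumes p: "p \<in> S" "0 < snd p"
  shows "p \<in> K"
proof -
  have "\<forall>\<^sub>F t in at_right (0::real). p - t *\<^sub>R \<nu> p \<in> K"
    using normal p by (auto simp: outward_unit_normal_def elim!: eventually_mono)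
  moreover have "((\<lambda>t. p - t *\<^sub>R \<nu> p) \<longlongrightarrow> p - 0 *\<^sub>R \<nu> p) (at_right (0::real))"
    by (intro tendsto_intros)
  ultimately have "p - 0 *\<^sub>R \<nu> p \<in> K"
    using compact_imp_closed[OF K_compact] by (intro Lim_in_closed_set[where F = "at_right 0"]) auto
  then show ?thesis by simp
qed

text \<open>
  If the hypersurface were contained in the plane near a rim point, its tangent space there would be horizontal, and the
  normal would be vertical. This contradicts a contact angle strictly between 0 and a right angle.
\<close>

lemma upper_points_near:
  assumes p: "p \<in> S" "snd p = 0" and \<epsilon>: "0 < \<epsilon>"
  shows "\<exists>q\<in>S. 0 < snd q \<and> dist p q < \<epsilon>"
proof (rule ccontr)
  assume none: "\<not> (\<exists>q\<in>S. 0 < snd q \<and> dist p q < \<epsilon>)"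
  then have flat: "snd q = 0" if "q \<in> S" "dist p q < \<epsilon>" for q
  proof -
    have "\<not> 0 < snd q" using none that by blast
    moreover have "0 \<le> snd q" using S_half that(1) by (auto simp: closed_halfspace_def)
    ultimately show ?thesis by simp
  qed
  have "p \<in> mfd_boundary S" using p bdry_eq by (simp add: bdry_plane_def)
  then obtain \<phi> k where ch: "slice_chart S {y. snd y = 0 \<and> 0 \<le> fst y $ k} p \<phi>" and k: "fst (\<phi> p) $ k = 0"
    unfolding mfd_boundary_def by blast
  obtain L where L: "linear L" "surj L" and yM: "\<phi> p \<in> {y. snd y = 0 \<and> 0 \<le> fst y $ k}"
    and cur: "\<And>v. (\<And>t. 0 \<le> t \<Longrightarrow> \<phi> p + t *\<^sub>R v \<in> {y. snd y = 0 \<and> 0 \<le> fst y $ k}) \<Longrightarrow>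
      \<exists>\<gamma> \<epsilon>. 0 < \<epsilon> \<and> \<gamma> 0 = p \<and> (\<forall>t\<in>{0..<\<epsilon>}. \<gamma> t \<in> S) \<and>
        (\<gamma> has_vector_derivative L v) (at_right (0::real))"
    using slice_chart_derivative[OF ch p(1)] by blast
  have one: "\<nu> p \<bullet> L v = 0 \<and> (0, 1) \<bullet> L v = 0" if v: "snd v = 0" "0 \<le> fst v $ k" for v
  proof -
    obtain \<gamma> e where \<gamma>: "0 < e" "\<gamma> 0 = p" "\<forall>t\<in>{0..<e}. \<gamma> t \<in> S" "(\<gamma> has_vector_derivative L v) (at_right (0::real))"
      using cur[of v] v k yM by auto
    have "L v \<in> tangent_space S p"
      unfolding tangent_space_def by (intro span_base) (use \<gamma> in blast)
    then have 1: "\<nu> p \<bullet> L v = 0" using normal p(1) by (auto simp: outward_unit_normal_def)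
    have "continuous (at_right 0) \<gamma>" using \<gamma>(4)
      by (rule has_vector_derivative_continuous)
    then have "(\<gamma> \<longlongrightarrow> p) (at_right 0)" using \<gamma>(2) by (simp add: continuous_within)
    then have "\<forall>\<^sub>F t in at_right 0. dist (\<gamma> t) p < \<epsilon>" using \<epsilon> by (rule tendstoD)
    then obtain b where b: "0 < b" "\<And>t. 0 < t \<Longrightarrow> t < b \<Longrightarrow> dist (\<gamma> t) p < \<epsilon>"
      unfolding eventually_at_right_field by auto
    have z: "snd (\<gamma> t) = 0" if "t \<in> {0<..<min b e}" for t
      using that b \<gamma>(3) by (intro flat) (auto simp: dist_commute)
    \<comment> \<open>both signs, because the curve stays in the plane\<close>
    have "(0, 1) \<bullet> L v \<le> 0"
      by (rule velocity_le_0[OF \<gamma>(4), of "min b e"]) (use b \<gamma> p z in \<open>auto simp: inner_prod_def\<close>)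
    moreover have "(0, -1) \<bullet> L v \<le> 0"
      by (rule velocity_le_0[OF \<gamma>(4), of "min b e"]) (use b \<gamma> p z in \<open>auto simp: inner_prod_def\<close>)
    ultimately show ?thesis using 1 by (auto simp: inner_prod_def)
  qed
  have both: "\<nu> p \<bullet> L v = 0 \<and> (0, 1) \<bullet> L v = 0" if v: "snd v = 0" for v
  proof (cases "0 \<le> fst v $ k")
    case False
    then have "\<nu> p \<bullet> L (- v) = 0 \<and> (0, 1) \<bullet> L (- v) = 0" using v by (intro one) auto
    then show ?thesis by (simp add: linear_neg[OF L(1)])
  qed (use one v in blast)
  have "\<nu> p \<noteq> 0" using norm_\<nu>[OF p(1)] by auto
  then obtain c where c: "(0, 1) = c *\<^sub>R \<nu> p"
    using normal_line_unique[OF L, of "\<nu> p" "(0, 1)"] both by blast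
  then have "norm ((0::real^'n), 1::real) = \<bar>c\<bar>" using norm_\<nu>[OF p(1)] by simp
  then have "\<bar>c\<bar> = 1" by (simp add: norm_Pair)
  moreover have "1 = c * cos \<theta>" using c angle[OF p] by (metis snd_conv snd_scaleR real_scaleR_def)
  ultimately show False using cos_pos cos_lt_1 by (auto simp: abs_if split: if_splits)
qed

lemma S_subset_K: "S \<subseteq> K"
proof
  fix p assume p: "p \<in> S"
  show "p \<in> K"
  proof (cases "0 < snd p")
    case False
    then have 0: "snd p = 0" using p S_half by (force simp: closed_halfspace_def)
    have "\<exists>q\<in>K. dist q p < \<epsilon>" if "0 < \<epsilon>" for \<epsilon>
      using upper_points_near[OF p 0 that] upper_point_in_K by (metis dist_commute)
    then show ?thesis
      using closure_approachable[of p K] closure_closed[OF compact_imp_closed[OF K_compact]] by simp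
  qed (use upper_point_in_K p in blast)
qed

text \<open>
  The point is a frontier point of the convex body, so it has a supporting hyperplane. Curves in \<open>S\<close> through it stay in
  the body, which makes the hyperplane tangent to \<open>S\<close>; the outward direction fixes the sign.
\<close>

lemma support_upper:
  assumes p: "p \<in> S" "0 < snd p" and x: "x \<in> K"
  shows "\<nu> p \<bullet> (x - p) \<le> 0"
proof -
  have "p \<notin> mfd_boundary S" using p bdry_eq by (auto simp: bdry_plane_def)
  then have "p \<in> mfd_interior S" using smooth p by (auto simp: smooth_hypersurface_def)
  then obtain \<phi> where ch: "slice_chart S {y. snd y = 0} p \<phi>" unfolding mfd_interior_def by blast
  obtain L where L: "linear L" "surj L" and yM: "\<phi> p \<in> {y. snd y = 0}"
    and cur: "\<And>v. (\<And>t. 0 \<le> t \<Longrightarrow> \<phi> p + t *\<^sub>R v \<in> {y. snd y = 0}) \<Longrightarrow>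
      \<exists>\<gamma> \<epsilon>. 0 < \<epsilon> \<and> \<gamma> 0 = p \<and> (\<forall>t\<in>{0..<\<epsilon>}. \<gamma> t \<in> S) \<and>
        (\<gamma> has_vector_derivative L v) (at_right (0::real))"
    using slice_chart_derivative[OF ch p(1)] by blast
  have pK: "p \<in> K" using p S_subset_K by blast
  have ev: "\<forall>\<^sub>F t in at_right 0. p + t *\<^sub>R \<nu> p \<notin> K \<and> p - t *\<^sub>R \<nu> p \<in> K"
    using normal p by (auto simp: outward_unit_normal_def)
  then obtain b where b: "0 < b" "\<And>t. 0 < t \<Longrightarrow> t < b \<Longrightarrow> p + t *\<^sub>R \<nu> p \<notin> K \<and> p - t *\<^sub>R \<nu> p \<in> K"
    unfolding eventually_at_right_field by auto
  have "p \<notin> interior K"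
  proof
    assume "p \<in> interior K"
    then obtain d where d: "0 < d" "ball p d \<subseteq> K" by (auto simp: mem_interior)
    \<comment> \<open>a step along \<open>\<nu> p\<close> that would stay in the body but has to leave it\<close>
    define t where "t = min b d / 2"
    have t: "0 < t" "t < b" "t < d" using b(1) d(1) by (auto simp: t_def)
    then have "p + t *\<^sub>R \<nu> p \<in> ball p d" using norm_\<nu>[OF p(1)] by (simp add: dist_norm)
    then show False using d(2) b(2)[OF t(1,2)] by blast
  qed
  moreover have intne: "interior K \<noteq> {}" using pK by (intro interior_enclosed_nonempty[OF S_half compact_S]) auto
  ultimately have nri: "p \<notin> rel_interior K" by (simp add: rel_interior_nonempty_interior)
  have "\<exists>a. a \<noteq> 0 \<and> (\<forall>y\<in>closure K. a \<bullet> p \<le> a \<bullet> y)"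
    by (rule supporting_hyperplane_relative_frontier[OF conv subsetD[OF closure_subset pK] nri]) blast
  then obtain a where a: "a \<noteq> 0" "\<And>y. y \<in> closure K \<Longrightarrow> a \<bullet> p \<le> a \<bullet> y" by blast
  define w where "w = - a"
  have w: "w \<noteq> 0" "\<And>y. y \<in> K \<Longrightarrow> w \<bullet> (y - p) \<le> 0"
    using a(1) a(2)[OF subsetD[OF closure_subset]] by (auto simp: w_def inner_diff_right simp del: split_paired_All)
  have one: "\<nu> p \<bullet> L v = 0 \<and> w \<bullet> L v \<le> 0" if v: "snd v = 0" for v
  proof -
    obtain \<gamma> e where \<gamma>: "0 < e" "\<gamma> 0 = p" "\<forall>t\<in>{0..<e}. \<gamma> t \<in> S" "(\<gamma> has_vector_derivative L v) (at_right (0::real))"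
      using cur[of v] v yM by auto
    have "L v \<in> tangent_space S p"
      unfolding tangent_space_def by (intro span_base) (use \<gamma> in blast)
    then have 1: "\<nu> p \<bullet> L v = 0" using normal p(1) by (auto simp: outward_unit_normal_def)
    have "w \<bullet> L v \<le> 0"
    proof (rule velocity_le_0[OF \<gamma>(4,1)])
      fix t assume "t \<in> {0<..<e}"
      then have "\<gamma> t \<in> K" using \<gamma>(3) S_subset_K by force
      then show "w \<bullet> (\<gamma> t - \<gamma> 0) \<le> 0" unfolding \<gamma>(2) by (rule w(2))
    qed
    then show ?thesis using 1 by simp
  qed
  have both: "\<nu> p \<bullet> L v = 0 \<and> w \<bullet> L v = 0" if v: "snd v = 0" for v
    using one[of v] one[of "- v"] v by (simp add: linear_neg[OF L(1)])
  have "\<nu> p \<noteq> 0" using norm_\<nu>[OF p(1)] by auto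
  then obtain c where c: "w = c *\<^sub>R \<nu> p"
    using normal_line_unique[OF L, of "\<nu> p" w] both by blast
  have "\<nu> p \<bullet> \<nu> p = 1" using norm_\<nu>[OF p(1)] by (simp add: dot_square_norm)
  moreover have "w \<bullet> (p - (b/2) *\<^sub>R \<nu> p - p) \<le> 0" using b by (intro w(2)) auto
  ultimately have "0 \<le> c" using b(1) by (simp add: c zero_le_mult_iff)
  then have "0 < c" using w(1) c by (cases "c = 0") auto
  moreover have "c * (\<nu> p \<bullet> (x - p)) \<le> 0" using w(2)[OF x] by (simp add: c)
  ultimately show ?thesis by (simp add: mult_le_0_iff)
qed

text \<open>
  At the rim the supporting property is inherited from nearby points above the plane, by continuity of the normal.
\<close>

lemma support:
  assumes p: "p \<in> S" and x: "x \<in> K"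
  shows "\<nu> p \<bullet> (x - p) \<le> 0"
proof (cases "0 < snd p")
  case False
  then have 0: "snd p = 0" using p S_half by (force simp: closed_halfspace_def)
  have "\<exists>q. q \<in> S \<and> 0 < snd q \<and> dist p q < inverse (real (Suc i))" for i
    using upper_points_near[OF p 0, of "inverse (real (Suc i))"] by (metis inverse_positive_iff_positive of_nat_0_less_iff zero_less_Suc)
  then obtain q where q: "\<And>i. q i \<in> S" "\<And>i. 0 < snd (q i)" "\<And>i. dist p (q i) < inverse (real (Suc i))"
    by metis
  have lim: "q \<longlonglongrightarrow> p"
    by (rule metric_tendsto_imp_tendsto[OF LIMSEQ_inverse_real_of_nat])
       (use q(3) in \<open>auto simp: dist_commute less_imp_le intro!: always_eventually\<close>)
  have "continuous_on S \<nu>" using normal by (auto simp: outward_unit_normal_def)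
  then have "(\<lambda>i. \<nu> (q i)) \<longlonglongrightarrow> \<nu> p"
    using lim p q(1) by (auto simp: continuous_on_sequentially o_def)
  then have "(\<lambda>i. \<nu> (q i) \<bullet> (x - q i)) \<longlonglongrightarrow> \<nu> p \<bullet> (x - p)"
    using lim by (intro tendsto_intros)
  moreover have "\<nu> (q i) \<bullet> (x - q i) \<le> 0" for i using q x by (intro support_upper)
  ultimately show ?thesis by (intro LIMSEQ_le_const2) auto
qed (use support_upper p x in blast)

lemma interior_K_ne: "interior K \<noteq> {}"
  using bdry_ne bdry_eq S_subset_K by (intro interior_enclosed_nonempty[OF S_half compact_S]) auto


lemma S_nonempty: "S \<noteq> {}" and bdry_point: "\<exists>p\<in>S. snd p = 0"
  using bdry_ne bdry_eq by (auto simp: bdry_plane_def)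

lemma closed_K: "closed K" by (rule compact_imp_closed[OF K_compact])

lemma K_closure_interior: "closure (interior K) = K"
  using convex_closure_interior[OF conv interior_K_ne] closure_closed[OF closed_K] by simp

lemma snd_nonneg: "x \<in> K \<Longrightarrow> 0 \<le> snd x"
  using K_half by (auto simp: closed_halfspace_def)

lemma interior_K_snd: assumes "q \<in> interior K" shows "0 < snd q"
proof -
  obtain d where d: "0 < d" "ball q d \<subseteq> K" using assms by (auto simp: mem_interior)
  have "q - (d/2) *\<^sub>R (0, 1) \<in> K" using d by (intro subsetD[OF d(2)]) (simp add: dist_norm norm_Pair)
  then have "0 \<le> snd (q - (d/2) *\<^sub>R (0, 1))" by (rule snd_nonneg)
  then show ?thesis using d(1) by simp
qed

lemma upper_frontier_in_S: "x \<in> frontier K \<Longrightarrow> 0 < snd x \<Longrightarrow> x \<in> S"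
  using K_frontier by (auto simp: bdry_plane_def)

lemma segment_in_K: "x \<in> K \<Longrightarrow> y \<in> K \<Longrightarrow> 0 \<le> t \<Longrightarrow> t \<le> 1 \<Longrightarrow> x + t *\<^sub>R (y - x) \<in> K"
  using convexD[OF conv, of x y "1 - t" t] by (simp add: algebra_simps)

text \<open>
  A segment that leaves the body on its way down to the plane does so strictly above the plane, and there the frontier
  of the body consists of points of \<open>S\<close>.
\<close>

lemma crossing_point:
  assumes k: "k \<in> K" "0 < snd k" and y: "y \<notin> K" "snd y = 0"
  shows "\<exists>\<mu>. 0 < \<mu> \<and> \<mu> \<le> 1 \<and> y + \<mu> *\<^sub>R (k - y) \<in> S"
proof -
  have "closed_segment y k \<inter> frontier K \<noteq> {}"
    using k(1) y(1) by (intro connected_Int_frontier) auto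
  then obtain u where u: "0 \<le> u" "u \<le> 1" "(1 - u) *\<^sub>R y + u *\<^sub>R k \<in> frontier K"
    by (auto simp: closed_segment_def)
  then have f: "y + u *\<^sub>R (k - y) \<in> frontier K" by (simp add: algebra_simps)
  then have "u \<noteq> 0" using y(1) closed_K frontier_subset_closed by force
  then have "0 < u" using u by simp
  moreover have "y + u *\<^sub>R (k - y) \<in> S"
    using f \<open>0 < u\<close> k(2) y(2) by (intro upper_frontier_in_S) auto
  ultimately show ?thesis using u by blast
qed

text \<open>
  Near such a point there are points of the plane outside the body and points of the body above the plane; the segments between
  them meet \<open>S\<close> arbitrarily close to it.
\<close>

lemma flat_boundary_in_S:
  assumes p: "p \<in> K" "snd p = 0" and near: "\<And>\<epsilon>. 0 < \<epsilon> \<Longrightarrow> \<exists>y. snd y = 0 \<and> y \<notin> K \<and> dist p y < \<epsilon>"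
  shows "p \<in> S"
proof -
  obtain q where q: "q \<in> interior K" using interior_K_ne by blast
  have qK: "q \<in> K" using q interior_subset by blast
  have "\<exists>x\<in>S. dist x p < \<epsilon>" if \<epsilon>: "0 < \<epsilon>" for \<epsilon>
  proof -
    obtain y where y: "snd y = 0" "y \<notin> K" "dist p y < \<epsilon>" using near[OF \<epsilon>] by blast
    define \<tau> where "\<tau> = min 1 (\<epsilon> / (norm (q - p) + 1))"
    have \<tau>: "0 < \<tau>" "\<tau> \<le> 1" using \<epsilon> by (auto simp: \<tau>_def add_nonneg_pos)
    define k where "k = p + \<tau> *\<^sub>R (q - p)"
    have "k \<in> K" unfolding k_def using p qK \<tau> by (intro segment_in_K) auto
    moreover have "0 < snd k" using p \<tau> interior_K_snd[OF q] by (simp add: k_def)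
    ultimately obtain \<mu> where \<mu>: "0 < \<mu>" "\<mu> \<le> 1" "y + \<mu> *\<^sub>R (k - y) \<in> S"
      using crossing_point y by blast
    have "dist p k = \<tau> * norm (q - p)" using \<tau> by (simp add: k_def dist_norm)
    also have "\<dots> < \<tau> * (norm (q - p) + 1)" using \<tau> by (intro mult_strict_left_mono) auto
    also have "\<dots> \<le> \<epsilon>"
    proof -
      have "\<tau> \<le> \<epsilon> / (norm (q - p) + 1)" by (simp add: \<tau>_def)
      then show ?thesis by (simp add: pos_le_divide_eq add_nonneg_pos)
    qed
    finally have "dist p k < \<epsilon>" .
    then have "closed_segment y k \<subseteq> ball p \<epsilon>"
      using y(3) by (intro closed_segment_subset convex_ball) auto
    moreover have "y + \<mu> *\<^sub>R (k - y) \<in> closed_segment y k"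
      using \<mu> by (auto simp: closed_segment_def algebra_simps intro!: exI[of _ \<mu>])
    ultimately have "dist p (y + \<mu> *\<^sub>R (k - y)) < \<epsilon>" by auto
    then show ?thesis using \<mu>(3) by (metis dist_commute)
  qed
  then show ?thesis
    using closure_approachable[of p S] closure_closed[OF compact_imp_closed[OF compact_S]] by simp
qed

lemma strict_support:
  assumes p: "p \<in> S" and q: "q \<in> interior K"
  shows "\<nu> p \<bullet> (q - p) < 0"
proof -
  obtain d where d: "0 < d" "ball q d \<subseteq> K" using q by (auto simp: mem_interior)
  have "q + (d/2) *\<^sub>R \<nu> p \<in> K"
    using d norm_\<nu>[OF p] by (intro subsetD[OF d(2)]) (simp add: dist_norm)
  then have "\<nu> p \<bullet> (q + (d/2) *\<^sub>R \<nu> p - p) \<le> 0" by (rule support[OF p])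
  moreover have "\<nu> p \<bullet> \<nu> p = 1" using norm_\<nu>[OF p] by (simp add: dot_square_norm)
  ultimately show ?thesis using d(1) by (simp add: algebra_simps inner_diff_right inner_add_right)
qed

text \<open>
  Suppose the foot of \<open>q\<close> lies outside the flat part, and let \<open>p\<close> be the point of the flat part closest to it. For small
  \<open>\<tau>\<close> the vertical segment below \<open>p + \<tau> (q - p)\<close> starts in the body and ends outside, so it meets \<open>S\<close> in a point
  \<open>p + \<tau> d\<close> where \<open>d\<close> lies below \<open>q - p\<close>. The normal at that point is nonnegative on \<open>d\<close>, since the supporting half-space
  contains \<open>p\<close>. But \<open>\<nu> p\<close> is negative on \<open>q - p\<close>, and even smaller on \<open>d\<close>, because its vertical component \<open>cos \<theta>\<close> is positive.
  For \<open>\<tau>\<close> tending to 0 this contradicts the continuity of \<open>\<nu>\<close>.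
  A consequence is that the flat part has interior points.
\<close>

lemma interior_projection_in_K:
  assumes q: "q \<in> interior K"
  shows "(fst q, 0) \<in> K"
proof (rule ccontr)
  define c where "c = (fst q, 0 :: real)"
  define h where "h = snd q"
  assume "(fst q, 0) \<notin> K"
  then have cK: "c \<notin> K" by (simp add: c_def)
  define F where "F = K \<inter> bdry_plane"
  have F: "closed F" "F \<noteq> {}"
    using closed_K closed_bdry_plane bdry_point S_subset_K by (auto simp: F_def bdry_plane_def intro: closed_Int)
  define p where "p = closest_point F c"
  have "p \<in> F" unfolding p_def by (rule closest_point_in_set[OF F])
  then have p: "p \<in> K" "snd p = 0" by (auto simp: F_def bdry_plane_def)
  define v where "v = c - p"
  have v: "v \<noteq> 0" using cK p by (auto simp: v_def)
  have qK: "q \<in> K" using q interior_subset by blast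
  have h: "0 < h" unfolding h_def by (rule interior_K_snd[OF q])
  have qv: "q - p = v + (0, h)" by (simp add: v_def c_def h_def prod_eq_iff)
  have out: "p + \<tau> *\<^sub>R v \<notin> K" if \<tau>: "0 < \<tau>" "\<tau> \<le> 1" for \<tau>
  proof
    assume "p + \<tau> *\<^sub>R v \<in> K"
    moreover have "snd (p + \<tau> *\<^sub>R v) = 0" using p by (simp add: v_def c_def)
    ultimately have "dist c p \<le> dist c (p + \<tau> *\<^sub>R v)"
      unfolding p_def[symmetric] using closest_point_le[OF F(1), of "p + \<tau> *\<^sub>R v" c]
      by (simp add: F_def bdry_plane_def p_def)
    also have "c - (p + \<tau> *\<^sub>R v) = (1 - \<tau>) *\<^sub>R v" by (simp add: v_def algebra_simps)
    then have "dist c (p + \<tau> *\<^sub>R v) = (1 - \<tau>) * norm v" using \<tau> by (simp add: dist_norm)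
    finally have "\<tau> * norm v \<le> 0" by (simp add: dist_norm v_def[symmetric] algebra_simps)
    moreover have "0 < \<tau> * norm v" using v \<tau> by simp
    ultimately show False by simp
  qed
  define \<tau> where "\<tau> i = inverse (real (Suc i))" for i
  have \<tau>: "0 < \<tau> i" "\<tau> i \<le> 1" for i by (auto simp: \<tau>_def divide_simps)
  have "\<exists>\<mu>. 0 < \<mu> \<and> \<mu> \<le> 1 \<and> p + \<tau> i *\<^sub>R (v + \<mu> *\<^sub>R (0, h)) \<in> S" for i
  proof -
    have "p + \<tau> i *\<^sub>R (q - p) \<in> K" using p qK \<tau>[of i] by (intro segment_in_K) auto
    moreover have "0 < snd (p + \<tau> i *\<^sub>R (q - p))" using p \<tau>[of i] h by (simp add: h_def)
    moreover have "snd (p + \<tau> i *\<^sub>R v) = 0" using p by (simp add: v_def c_def)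
    ultimately obtain \<mu> where "0 < \<mu>" "\<mu> \<le> 1"
      "p + \<tau> i *\<^sub>R v + \<mu> *\<^sub>R (p + \<tau> i *\<^sub>R (q - p) - (p + \<tau> i *\<^sub>R v)) \<in> S"
      using crossing_point out[OF \<tau>] by blast
    moreover have "p + \<tau> i *\<^sub>R v + \<mu> *\<^sub>R (p + \<tau> i *\<^sub>R (q - p) - (p + \<tau> i *\<^sub>R v)) = p + \<tau> i *\<^sub>R (v + \<mu> *\<^sub>R (0, h))"
      unfolding qv by (simp add: algebra_simps)
    ultimately show ?thesis by metis
  qed
  then obtain \<mu> where \<mu>: "\<And>i. 0 < \<mu> i" "\<And>i. \<mu> i \<le> 1"
    and xS: "\<And>i. p + \<tau> i *\<^sub>R (v + \<mu> i *\<^sub>R (0, h)) \<in> S" by metis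
  define d where "d i = v + \<mu> i *\<^sub>R (0, h)" for i
  define x where "x i = p + \<tau> i *\<^sub>R d i" for i
  have xS: "x i \<in> S" for i using xS by (simp add: x_def d_def)
  have nd: "norm (d i) \<le> norm v + h" for i
  proof -
    have "norm (d i) \<le> norm v + norm (\<mu> i *\<^sub>R (0 :: real^'n, h))" unfolding d_def by (rule norm_triangle_ineq)
    also have "norm (\<mu> i *\<^sub>R (0 :: real^'n, h)) = \<mu> i * h" using \<mu>[of i] h by (simp add: norm_Pair)
    also have "\<dots> \<le> h" using \<mu>[of i] h by (simp add: mult_left_le_one_le)
    finally show ?thesis by simp
  qed
  have \<tau>0: "\<tau> \<longlonglongrightarrow> 0" unfolding \<tau>_def by (rule LIMSEQ_inverse_real_of_nat)
  have "(\<lambda>i. \<tau> i *\<^sub>R d i) \<longlonglongrightarrow> 0"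
  proof (rule Lim_null_comparison)
    show "\<forall>\<^sub>F i in sequentially. norm (\<tau> i *\<^sub>R d i) \<le> \<tau> i * (norm v + h)"
      using \<tau> nd by (auto intro!: always_eventually mult_left_mono simp: less_imp_le)
    show "(\<lambda>i. \<tau> i * (norm v + h)) \<longlonglongrightarrow> 0" using tendsto_mult_left_zero[OF \<tau>0] .
  qed
  then have "(\<lambda>i. p + \<tau> i *\<^sub>R d i) \<longlonglongrightarrow> p + 0" by (intro tendsto_add tendsto_const)
  then have lim: "x \<longlonglongrightarrow> p" unfolding x_def[abs_def] by simp
  have pS: "p \<in> S" using closed_sequentially[OF compact_imp_closed[OF compact_S] _ lim] xS by blast
  have "continuous_on S \<nu>" using normal by (auto simp: outward_unit_normal_def)
  then have "(\<lambda>i. \<nu> (x i)) \<longlonglongrightarrow> \<nu> p" using lim pS xS by (auto simp: continuous_on_sequentially o_def)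
  then have n0: "(\<lambda>i. norm (\<nu> (x i) - \<nu> p)) \<longlonglongrightarrow> 0"
    by (simp add: LIM_zero_iff tendsto_norm_zero_iff)
  define a where "a = \<nu> p \<bullet> (q - p)"
  have "a < 0" unfolding a_def by (rule strict_support[OF pS q])
  have "0 \<le> norm (\<nu> (x i) - \<nu> p) * (norm v + h) + a" for i
  proof -
    \<comment> \<open>the supporting half-space at \<open>x i\<close> contains \<open>p\<close>\<close>
    have "\<nu> (x i) \<bullet> (p - x i) \<le> 0" using xS p by (intro support)
    then have "0 \<le> \<tau> i * (\<nu> (x i) \<bullet> d i)" by (simp add: x_def)
    then have "0 \<le> \<nu> (x i) \<bullet> d i" using \<tau>[of i] by (simp add: zero_le_mult_iff)
    also have "\<nu> (x i) \<bullet> d i = (\<nu> (x i) - \<nu> p) \<bullet> d i + \<nu> p \<bullet> d i" by (simp add: inner_diff_left)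
    also have "(\<nu> (x i) - \<nu> p) \<bullet> d i \<le> norm (\<nu> (x i) - \<nu> p) * (norm v + h)"
      by (rule order_trans[OF norm_cauchy_schwarz]) (intro mult_left_mono nd norm_ge_zero)
    also have "\<nu> p \<bullet> d i \<le> a"
    proof -
      have "\<nu> p \<bullet> d i = a - (1 - \<mu> i) * h * snd (\<nu> p)"
        unfolding a_def qv d_def by (simp add: inner_add_right inner_prod_def algebra_simps)
      moreover have "0 \<le> (1 - \<mu> i) * h * snd (\<nu> p)"
        using \<mu>[of i] h angle[OF pS p(2)] cos_pos by simp
      ultimately show ?thesis by simp
    qed
    finally show ?thesis by simp
  qed
  moreover have "(\<lambda>i. norm (\<nu> (x i) - \<nu> p) * (norm v + h) + a) \<longlonglongrightarrow> 0 * (norm v + h) + a"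
    by (intro tendsto_intros n0)
  ultimately have "0 \<le> 0 * (norm v + h) + a" by (intro LIMSEQ_le_const) auto
  then show False using \<open>a < 0\<close> by simp
qed

lemma projection_in_K:
  assumes "x \<in> K"
  shows "(fst x, 0) \<in> K"
proof -
  have "closed ((\<lambda>x :: 'n amb. (fst x, 0 :: real)) -` K)"
    by (intro continuous_closed_vimage closed_K continuous_intros)
  then have "closure (interior K) \<subseteq> (\<lambda>x :: 'n amb. (fst x, 0 :: real)) -` K"
    by (intro closure_minimal) (auto intro: interior_projection_in_K)
  then show ?thesis using assms K_closure_interior by auto
qed

text \<open>
  Let \<open>p\<close> be the point where the segment from the foot of \<open>x\<close> to \<open>y\<close> leaves the flat part. It belongs to \<open>S\<close>, and the
  supporting half-space at \<open>p\<close>, whose normal has horizontal part of length \<open>sin \<theta>\<close> and vertical part \<open>cos \<theta>\<close>,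
  would exclude \<open>x\<close> if \<open>y\<close> were that close to the foot.
\<close>

lemma shadow_ball:
  assumes x: "x \<in> K" and y: "dist (fst x) y * sin \<theta> < snd x * cos \<theta>"
  shows "(y, 0) \<in> K"
proof (rule ccontr)
  assume yK: "(y, 0) \<notin> K"
  define f where "f s = (fst x + s *\<^sub>R (y - fst x), 0 :: real)" for s
  have cf: "continuous_on UNIV f" unfolding f_def by (intro continuous_intros)
  define A where "A = {0..1} \<inter> f -` K"
  have "closed (f -` K)" using closed_K cf by (rule closed_vimage)
  then have "compact A" unfolding A_def by (intro compact_Int_closed) auto
  moreover have "0 \<in> A" using projection_in_K[OF x] by (simp add: A_def f_def)
  ultimately obtain s where s: "s \<in> A" "\<And>t. t \<in> A \<Longrightarrow> t \<le> s"
    using compact_attains_sup[of A] by blast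
  have s01: "0 \<le> s" "s < 1"
    using s(1) yK by (auto simp: A_def f_def less_le)
  have "\<exists>w. snd w = 0 \<and> w \<notin> K \<and> dist (f s) w < \<epsilon>" if "0 < \<epsilon>" for \<epsilon>
  proof -
    obtain d where d: "0 < d" "\<And>t. dist t s < d \<Longrightarrow> dist (f t) (f s) < \<epsilon>"
      using cf \<open>0 < \<epsilon>\<close> by (metis UNIV_I continuous_on_iff)
    define t where "t = min 1 (s + d / 2)"
    have t: "s < t" "t \<le> 1" "dist t s < d" using d(1) s01 by (auto simp: t_def dist_real_def)
    then have "t \<notin> A" using s(2) by force
    then have "f t \<notin> K" using t s01 by (auto simp: A_def)
    then show ?thesis using d(2)[OF t(3)] by (intro exI[of _ "f t"]) (auto simp: dist_commute f_def)
  qed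
  then have pS: "f s \<in> S" using s(1) by (intro flat_boundary_in_S) (auto simp: A_def f_def)
  define a where "a = fst (\<nu> (f s))"
  have sn: "snd (\<nu> (f s)) = cos \<theta>" using pS by (intro angle) (auto simp: f_def)
  have "(norm a)\<^sup>2 + (cos \<theta>)\<^sup>2 = 1"
    using norm_\<nu>[OF pS] sn unfolding a_def by (cases "\<nu> (f s)") (simp add: norm_Pair)
  then have "(norm a)\<^sup>2 = (sin \<theta>)\<^sup>2" by (simp add: sin_squared_eq)
  then have na: "norm a = sin \<theta>" using sin_pos by (simp add: power2_eq_iff_nonneg)
  have "\<nu> (f s) \<bullet> (x - f s) \<le> 0" using pS x by (rule support)
  moreover have "\<nu> (f s) \<bullet> (x - f s) = snd x * cos \<theta> - s * (a \<bullet> (y - fst x))"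
    using sn by (simp add: inner_prod_def f_def a_def)
  moreover have "s * (a \<bullet> (y - fst x)) \<le> 1 * (norm a * norm (y - fst x))"
  proof -
    have "s * (a \<bullet> (y - fst x)) \<le> s * (norm a * norm (y - fst x))"
      using s01 by (intro mult_left_mono norm_cauchy_schwarz)
    also have "\<dots> \<le> 1 * (norm a * norm (y - fst x))" using s01 by (intro mult_right_mono) auto
    finally show ?thesis .
  qed
  ultimately show False using y na by (simp add: dist_norm norm_minus_commute mult.commute)
qed

lemma flat_interior_exists:
  obtains z0 \<delta> where "0 < \<delta>" "\<And>y. dist z0 y < \<delta> \<Longrightarrow> (y, 0) \<in> K"
proof -
  obtain q where q: "q \<in> interior K" using interior_K_ne by blast
  then obtain d where d: "0 < d" "ball q d \<subseteq> K" by (auto simp: mem_interior)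
  have "(y, 0) \<in> K" if "dist (fst q) y < d" for y
  proof -
    have "dist q (y, snd q) = dist (fst q) y" by (cases q) (simp add: dist_Pair_Pair)
    then have "(y, snd q) \<in> K" using that by (intro subsetD[OF d(2)]) simp
    then show ?thesis using projection_in_K by force
  qed
  then show ?thesis using d(1) that by blast
qed

end


section \<open>Radii and volume in terms of the width of the base\<close>

context convex_capillary
begin

definition base where "base = {y :: real^'n. (y, 0) \<in> K}"

lemma compact_base: "compact base"
proof -
  have "base = fst ` (K \<inter> bdry_plane)" by (force simp: base_def bdry_plane_def)
  moreover have "compact (K \<inter> bdry_plane)" using K_compact closed_bdry_plane by (rule compact_Int_closed)
  ultimately show ?thesis by (simp add: compact_continuous_image continuous_on_fst)
qed

lemma fst_in_base: "x \<in> K \<Longrightarrow> fst x \<in> base"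
  using projection_in_K by (simp add: base_def)

definition width where "width = diameter base"

lemma dist_le_width: "a \<in> base \<Longrightarrow> b \<in> base \<Longrightarrow> dist a b \<le> width"
  unfolding width_def by (rule diameter_bounded_bound[OF compact_imp_bounded[OF compact_base]])

lemma base_ne: "base \<noteq> {}"
  using flat_interior_exists unfolding base_def by (metis dist_self empty_iff mem_Collect_eq)

lemma width_attained: "\<exists>a\<in>base. \<exists>b\<in>base. dist a b = width"
  unfolding width_def by (rule diameter_compact_attained[OF compact_base base_ne])

lemma width_pos: "0 < width"
proof -
  obtain z0 \<delta> where z0: "0 < \<delta>" "\<And>y. dist z0 y < \<delta> \<Longrightarrow> (y, 0) \<in> K" by (rule flat_interior_exists) blast
  define y where "y = z0 + (\<delta> / 2) *\<^sub>R axis undefined 1"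
  have d: "dist z0 y = \<delta> / 2" using z0(1) by (simp add: y_def dist_norm)
  then have "y \<in> base" "z0 \<in> base" using z0 by (auto simp: base_def)
  then show ?thesis using dist_le_width[of z0 y] d z0(1) by simp
qed

text \<open>
  The disc of \<open>shadow_ball\<close> has to fit into the base.
\<close>

lemma height_le:
  assumes x: "x \<in> K"
  shows "snd x * cos \<theta> \<le> width * sin \<theta>"
proof (rule ccontr)
  assume n: "\<not> ?thesis"
  then obtain s where s: "width < s" "s < snd x * cos \<theta> / sin \<theta>"
    using dense[of width "snd x * cos \<theta> / sin \<theta>"] sin_pos by (auto simp: pos_less_divide_eq)
  define y where "y = fst x + s *\<^sub>R axis undefined 1"
  have d: "dist (fst x) y = s" using s width_pos by (simp add: y_def dist_norm)
  have "y \<in> base" unfolding base_def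
    using shadow_ball[OF x, of y] d s(2) sin_pos by (simp add: pos_less_divide_eq)
  then show False using dist_le_width[OF fst_in_base[OF x], of y] d s(1) by simp
qed

lemma bdd_below_outer: "bdd_below {r. 0 < r \<and> (\<exists>x0\<in>bdry_plane. K \<subseteq> enclosed (cap r \<theta> x0))}"
  by (intro bdd_belowI[of _ 0]) auto

text \<open>
  The body lies in the cylinder of radius \<open>width\<close> and height \<open>width tan \<theta>\<close> about any point of the base; the
  constant is large enough for the cap to contain the upper edge of this cylinder.
\<close>

lemma outer_radius_le: "outer_radius \<theta> K \<le> (2 + 1 / (cos \<theta>)\<^sup>2) / sin \<theta> * width"
proof -
  obtain y0 where y0: "y0 \<in> base" using base_ne by blast
  define m where "m = 2 + 1 / (cos \<theta>)\<^sup>2"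
  define r where "r = m / sin \<theta> * width"
  have m: "0 < m" by (simp add: m_def add_pos_nonneg)
  have r: "0 < r" using m sin_pos width_pos by (simp add: r_def)
  have "K \<subseteq> enclosed (cap r \<theta> (y0, 0))"
  proof
    fix x assume x: "x \<in> K"
    define w where "w = width"
    define t where "t = snd x"
    define v where "v = norm (fst x - y0)"
    have v: "0 \<le> v" "v \<le> w" using dist_le_width[OF fst_in_base[OF x] y0] by (auto simp: v_def w_def dist_norm)
    have t: "0 \<le> t" "t * cos \<theta> \<le> w * sin \<theta>" using snd_nonneg[OF x] height_le[OF x] by (auto simp: t_def w_def)
    then have t': "t \<le> w * sin \<theta> / cos \<theta>" using cos_pos by (simp add: pos_le_divide_eq)
    have rs: "r * sin \<theta> = m * w" using sin_pos by (simp add: r_def w_def)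
    have "v\<^sup>2 + (t + r * cos \<theta>)\<^sup>2 \<le> w\<^sup>2 + (w * sin \<theta> / cos \<theta> + r * cos \<theta>)\<^sup>2"
      using v t t' r cos_pos by (intro add_mono power_mono add_right_mono) auto
    also have "\<dots> = w\<^sup>2 * (1 + (sin \<theta>)\<^sup>2 / (cos \<theta>)\<^sup>2) + 2 * w * (r * sin \<theta>) + r\<^sup>2 * (cos \<theta>)\<^sup>2"
      using cos_pos by (simp add: power2_sum power_mult_distrib power_divide algebra_simps)
    \<comment> \<open>the inequality to be checked becomes \<open>(m - 1) * (m - 2) \<ge> 0\<close>\<close>
    also have "1 + (sin \<theta>)\<^sup>2 / (cos \<theta>)\<^sup>2 = m - 2"
      using cos_pos by (simp add: sin_squared_eq m_def diff_divide_distrib)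
    also have "w\<^sup>2 * (m - 2) + 2 * w * (r * sin \<theta>) + r\<^sup>2 * (cos \<theta>)\<^sup>2
        = w\<^sup>2 * ((m - 2) + 2 * m) + r\<^sup>2 - (r * sin \<theta>)\<^sup>2"
      unfolding rs by (simp add: cos_squared_eq rs[symmetric] power_mult_distrib algebra_simps)
        (simp add: rs power2_eq_square algebra_simps)
    also have "(r * sin \<theta>)\<^sup>2 = w\<^sup>2 * m\<^sup>2" unfolding rs by (simp add: power_mult_distrib)
    also have "w\<^sup>2 * ((m - 2) + 2 * m) + r\<^sup>2 - w\<^sup>2 * m\<^sup>2 = r\<^sup>2 - w\<^sup>2 * ((m - 1) * (m - 2))"
      by (simp add: algebra_simps power2_eq_square)
    also have "\<dots> \<le> r\<^sup>2" by (simp add: m_def)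
    finally have "(norm (fst x - y0))\<^sup>2 + (snd x + r * cos \<theta>)\<^sup>2 \<le> r\<^sup>2" by (simp add: v_def t_def)
    moreover have "x - ((y0, 0) + (r * cos \<theta>) *\<^sub>R e_vec) = (fst x - y0, snd x + r * cos \<theta>)"
      by (simp add: e_vec_def prod_eq_iff)
    ultimately have "norm (x - ((y0, 0) + (r * cos \<theta>) *\<^sub>R e_vec)) \<le> r"
      using r by (simp add: norm_Pair real_le_lsqrt)
    then show "x \<in> enclosed (cap r \<theta> (y0, 0))"
      using x K_half r \<theta> by (subst enclosed_cap) (auto simp: bdry_plane_def dist_norm norm_minus_commute)
  qed
  then have "r \<in> {r. 0 < r \<and> (\<exists>x0\<in>bdry_plane. K \<subseteq> enclosed (cap r \<theta> x0))}"
    using r by (auto simp: bdry_plane_def intro!: bexI[of _ "(y0, 0)"])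
  then have "outer_radius \<theta> K \<le> r" unfolding outer_radius_def
    using bdd_below_outer by (rule cInf_lower)
  then show ?thesis by (simp add: r_def m_def)
qed

text \<open>
  By convexity the body contains the cone with apex \<open>x\<close> over the disc of \<open>shadow_ball\<close>. A cap of radius \<open>r\<close> centred
  at the foot of \<open>x\<close> lies in the box of horizontal radius \<open>r\<close> and height less than \<open>r\<close>, and the value of \<open>r\<close> is such that the cone
  contains this box.
\<close>

lemma inner_radius_ge:
  assumes x: "x \<in> K" "0 < snd x"
  shows "snd x / (1 + tan \<theta>) \<le> inner_radius \<theta> K"
proof -
  define T where "T = tan \<theta>"
  have T: "0 < T" unfolding T_def using \<theta> by (rule tan_gt_zero)
  have Tc: "T * cos \<theta> = sin \<theta>" using cos_pos by (simp add: T_def tan_def)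
  define h where "h = snd x"
  define r where "r = h / (1 + T)"
  have r: "0 < r" using x T by (simp add: r_def h_def add_pos_pos)
  have rh: "r * (1 + T) = h" using T by (simp add: r_def)
  have "enclosed (cap r \<theta> (fst x, 0)) \<subseteq> K"
  proof
    fix z assume "z \<in> enclosed (cap r \<theta> (fst x, 0))"
    then have z: "0 \<le> snd z" "norm (z - ((fst x, 0) + (r * cos \<theta>) *\<^sub>R e_vec)) \<le> r"
      using r \<theta> by (auto simp: enclosed_cap bdry_plane_def closed_halfspace_def dist_norm norm_minus_commute)
    define t where "t = snd z"
    define v where "v = fst z - fst x"
    have e: "z - ((fst x, 0) + (r * cos \<theta>) *\<^sub>R e_vec) = (v, t + r * cos \<theta>)"
      by (simp add: e_vec_def prod_eq_iff v_def t_def)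
    have n: "norm v \<le> r" "norm (t + r * cos \<theta>) \<le> r"
      using z(2) unfolding e
      using norm_fst_le[of "v" "t + r * cos \<theta>"] norm_snd_le[of "t + r * cos \<theta>" v] by auto
    have t: "0 \<le> t" "t + r * cos \<theta> \<le> r" using z(1) n(2) by (auto simp: t_def)
    have "0 < r * cos \<theta>" using r cos_pos by simp
    then have tr: "t < r" using t by linarith
    have "0 < r * T" using r T by simp
    then have th: "t < h" using rh tr by (simp add: algebra_simps)
    have "norm v * T \<le> r * T" using n T by (intro mult_right_mono) auto
    then have key: "norm v * T < h - t" using rh tr by (simp add: algebra_simps)
    \<comment> \<open>\<open>z\<close> divides the segment from \<open>(y, 0)\<close> in the base to the apex in the ratio given by its height\<close>
    define l where "l = t / h"
    have h: "0 < h" using x by (simp add: h_def)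
    have l: "0 \<le> l" "l < 1" using t th h by (auto simp: l_def)
    have lh: "(1 - l) * h = h - t" using h by (simp add: l_def field_simps)
    define y where "y = fst x + (1 / (1 - l)) *\<^sub>R v"
    have "dist (fst x) y = norm v / (1 - l)" using l by (simp add: y_def dist_norm)
    moreover have "norm v / (1 - l) * sin \<theta> < h * cos \<theta>"
    proof -
      have "norm v * T < (1 - l) * h" using key lh by simp
      then have "norm v * T * cos \<theta> < (1 - l) * h * cos \<theta>" using cos_pos by simp
      then have "norm v * sin \<theta> < (1 - l) * (h * cos \<theta>)" using Tc by (simp add: mult.assoc)
      then show ?thesis using l by (simp add: divide_less_eq mult.commute)
    qed
    ultimately have yK: "(y, 0) \<in> K" using shadow_ball[OF x(1), of y] by (simp add: h_def)
    have "z = (y, 0) + l *\<^sub>R (x - (y, 0))"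
    proof -
      define w where "w = (1 / (1 - l)) *\<^sub>R v"
      have "v = (1 - l) *\<^sub>R w" using l by (simp add: w_def)
      then have "y + l *\<^sub>R (fst x - y) = fst x + v"
        by (simp add: y_def w_def[symmetric] algebra_simps)
      also have "\<dots> = fst z" by (simp add: v_def)
      finally show ?thesis using h by (simp add: prod_eq_iff l_def t_def h_def)
    qed
    then show "z \<in> K" using segment_in_K[OF yK x(1), of l] l by simp
  qed
  then have "r \<in> {r. 0 < r \<and> (\<exists>x0\<in>bdry_plane. enclosed (cap r \<theta> x0) \<subseteq> K)}"
    using r by (auto simp: bdry_plane_def intro!: bexI[of _ "(fst x, 0)"])
  moreover have "bdd_above {r. 0 < r \<and> (\<exists>x0\<in>bdry_plane. enclosed (cap r \<theta> x0) \<subseteq> K)}"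
  proof (rule bdd_aboveI)
    fix s assume "s \<in> {r. 0 < r \<and> (\<exists>x0\<in>bdry_plane. enclosed (cap r \<theta> x0) \<subseteq> K)}"
    then obtain x0 where s: "0 < s" and x0: "x0 \<in> bdry_plane" "enclosed (cap s \<theta> x0) \<subseteq> K" by blast
    \<comment> \<open>the top of the cap, whose height is bounded\<close>
    define z where "z = x0 + (s * (1 - cos \<theta>)) *\<^sub>R ((0, 1) :: 'n amb)"
    have "z - (x0 + (s * cos \<theta>) *\<^sub>R e_vec) = s *\<^sub>R (0, 1)"
      by (simp add: z_def e_vec_def prod_eq_iff algebra_simps)
    moreover have sz: "snd z = s * (1 - cos \<theta>)" using x0 by (simp add: z_def bdry_plane_def)
    moreover have "norm (s *\<^sub>R (0 :: real^'n, 1 :: real)) = s" using s by (simp add: norm_Pair)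
    ultimately have "z \<in> enclosed (cap s \<theta> x0)"
      using s x0 \<theta> cos_lt_1 by (simp add: enclosed_cap closed_halfspace_def dist_norm norm_minus_commute)
    then have "s * (1 - cos \<theta>) * cos \<theta> \<le> width * sin \<theta>" using height_le x0(2) sz by fastforce
    then show "s \<le> width * sin \<theta> / ((1 - cos \<theta>) * cos \<theta>)"
      using cos_pos cos_lt_1 by (simp add: pos_le_divide_eq mult.assoc)
  qed
  ultimately have "r \<le> inner_radius \<theta> K" unfolding inner_radius_def by (rule cSup_upper)
  then show ?thesis by (simp only: r_def h_def T_def)
qed

text \<open>
  The body lies over an \<open>n\<close>-dimensional cube of side \<open>2 width\<close>, and its maximal height is comparable to the inner radius.
\<close>

lemma volume_le: "measure lborel K \<le> (2 * width) ^ CARD('n) * (1 + tan \<theta>) * inner_radius \<theta> K"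
proof -
  have T: "0 < tan \<theta>" using \<theta> by (rule tan_gt_zero)
  have "K \<noteq> {}" using S_nonempty S_subset_K by blast
  then obtain x where x: "x \<in> K" "\<And>z. z \<in> K \<Longrightarrow> snd z \<le> snd x"
    using continuous_attains_sup[OF K_compact, of snd] continuous_on_snd[OF continuous_on_id] by blast
  obtain q where q: "q \<in> interior K" using interior_K_ne by blast
  have h: "0 < snd x" using x(2)[of q] interior_K_snd[OF q] q interior_subset by fastforce
  define one where "one = ((\<chi> i. width) :: real^'n)"
  define A where "A = cbox (fst x - one, 0) (fst x + one, snd x)"
  have "K \<subseteq> A"
  proof
    fix z assume z: "z \<in> K"
    have "norm (fst z - fst x) \<le> width"
      using dist_le_width[OF fst_in_base[OF z] fst_in_base[OF x(1)]] by (simp add: dist_norm)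
    then have "\<bar>fst z $ i - fst x $ i\<bar> \<le> width" for i
      using component_le_norm_cart[of "fst z - fst x" i] by simp
    then have "fst z \<in> cbox (fst x - one) (fst x + one)"
      by (auto simp: mem_box_cart one_def abs_le_iff algebra_simps)
    then show "z \<in> A"
      using x(2)[OF z] snd_nonneg[OF z] by (cases z) (auto simp: A_def cbox_Pair_eq)
  qed
  then have "measure lborel K \<le> measure lborel A"
    unfolding A_def using closed_K
    by (intro measure_mono_fmeasurable) (auto simp: fmeasurable_cbox)
  also have "\<dots> = measure lborel (cbox (fst x - one) (fst x + one)) * measure lborel (cbox 0 (snd x))"
    unfolding A_def by (simp add: content_Pair)
  also have "measure lborel (cbox (fst x - one) (fst x + one)) = (\<Prod>i\<in>(UNIV :: 'n set). 2 * width)"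
    using width_pos by (subst content_cbox_cart) (auto simp: one_def interval_ne_empty_cart)
  also have "\<dots> = (2 * width) ^ CARD('n)" by simp
  also have "measure lborel (cbox 0 (snd x)) = snd x" using h by simp
  also have "snd x \<le> (1 + tan \<theta>) * inner_radius \<theta> K"
    using inner_radius_ge[OF x(1) h] T by (simp add: divide_le_eq mult.commute)
  finally show ?thesis using width_pos by (simp add: mult_left_mono mult.assoc)
qed

end


section \<open>The capillary entropy bounds the width\<close>

text \<open>
  The layer-cake form of the logarithm: the sum counts the dyadic scales that are at least \<open>v\<close>. The truncation at \<open>(1/2) ^ N\<close>
  keeps the sum finite, so that no singular integral appears, and the bound is uniform in \<open>N\<close> after integration.
\<close>

lemma ln_max_ge_neg_dyadic_sum:
  fixes v :: real
  shows "- ln 2 * (\<Sum>j<N. if v \<le> (1/2) ^ j then 1 else 0) \<le> ln (max ((1/2) ^ N) v)"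
proof (induction N)
  case 0
  then show ?case by simp
next
  case (Suc N)
  show ?case
  proof (cases "v \<le> (1/2) ^ N")
    case True
    have "(\<Sum>j<Suc N. if v \<le> (1/2) ^ j then 1 else 0) = (\<Sum>j<Suc N. 1 :: real)"
    proof (rule sum.cong[OF refl])
      fix j assume "j \<in> {..<Suc N}"
      then have le: "(1/2) ^ N \<le> ((1/2) ^ j :: real)" by (intro power_decreasing) auto
      show "(if v \<le> (1/2) ^ j then 1 else 0) = (1::real)" using order_trans[OF True le] by simp
    qed
    then have "- ln 2 * (\<Sum>j<Suc N. if v \<le> (1/2) ^ j then 1 else 0) = - ln 2 * real (Suc N)" by simp
    also have "\<dots> = ln ((1/2) ^ Suc N)"
      using ln_realpow[of "1/2 :: real" "Suc N"] by (simp add: ln_div algebra_simps)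
    also have "\<dots> \<le> ln (max ((1/2) ^ Suc N) v)"
      by (subst ln_le_cancel_iff) (auto simp: less_max_iff_disj)
    finally show ?thesis .
  next
    case False
    have "(1/2) ^ Suc N \<le> ((1/2) ^ N :: real)" by (intro power_decreasing) auto
    then have "(1/2) ^ Suc N \<le> v" "(1/2) ^ N \<le> v" using False by linarith+
    then have "max ((1/2) ^ Suc N) v = v" "max ((1/2) ^ N) v = v" by (simp_all only: max_absorb2)
    then show ?thesis using Suc False by simp
  qed
qed

lemma (in acute_angle) cap_direction:
  fixes \<xi> :: "'n::finite amb"
  assumes "\<xi> \<in> cap 1 \<theta> 0"
  shows "norm (\<xi> - cos \<theta> *\<^sub>R e_vec) = 1" "0 < snd (\<xi> - cos \<theta> *\<^sub>R e_vec)"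
    "fst (\<xi> - cos \<theta> *\<^sub>R e_vec) = fst \<xi>"
  using assms cos_pos by (auto simp: cap_def e_vec_def closed_halfspace_def)

lemma compact_cap: "compact (cap r \<theta> (x0 :: 'n::finite amb))"
proof -
  have "cap r \<theta> x0 = sphere (x0 + (r * cos \<theta>) *\<^sub>R e_vec) r \<inter> closed_halfspace"
    by (auto simp: cap_def dist_norm norm_minus_commute)
  then show ?thesis by (simp add: compact_Int_closed closed_closed_halfspace)
qed

lemma (in acute_angle) cap_ne: "cap 1 \<theta> (0 :: 'n::finite amb) \<noteq> {}"
  using cap_param_in_cap[of 0] sin_pos by force

context convex_capillary
begin

definition sup_S :: "'n amb \<Rightarrow> 'n amb \<Rightarrow> real" where
  "sup_S z \<eta> = (SUP X\<in>S. \<eta> \<bullet> (X - z))"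

lemma bdd_sup_S: "bdd_above ((\<lambda>X. \<eta> \<bullet> (X - z)) ` S)"
  by (intro bounded_imp_bdd_above compact_imp_bounded compact_continuous_image compact_S continuous_intros)

lemma cap_support_eq: "cap_support \<theta> S z \<xi> = sup_S z (\<xi> - cos \<theta> *\<^sub>R e_vec) / cap_ell \<theta> \<xi>"
  by (simp add: cap_support_def sup_S_def divide_inverse)

text \<open>
  In an upward direction it makes no difference whether the supremum is taken over \<open>S\<close> or over the body:
  moving up from an interior point increases
  the linear function until the frontier is reached, above the plane.
\<close>

lemma inner_le_sup_S:
  assumes \<eta>: "0 < snd \<eta>" and k: "k \<in> K"
  shows "\<eta> \<bullet> (k - z) \<le> sup_S z \<eta>"
proof -
  have "interior K \<subseteq> {k. \<eta> \<bullet> (k - z) \<le> sup_S z \<eta>}"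
  proof
    fix q assume q: "q \<in> interior K"
    then have qK: "q \<in> K" using interior_subset by blast
    \<comment> \<open>higher than any point of the body\<close>
    define M where "M = width * sin \<theta> / cos \<theta> + 1"
    have M: "0 < M" unfolding M_def using width_pos sin_pos cos_pos by (intro add_nonneg_pos) auto
    define far where "far = q + M *\<^sub>R (0, 1)"
    have "far \<notin> K"
    proof
      assume "far \<in> K"
      then have "(snd q + M) * cos \<theta> \<le> width * sin \<theta>" using height_le[of far] by (simp add: far_def)
      moreover have "M * cos \<theta> = width * sin \<theta> + cos \<theta>" using cos_pos by (simp add: M_def field_simps)
      moreover have "0 < snd q * cos \<theta>" using interior_K_snd[OF q] cos_pos by simp
      ultimately show False using cos_pos by (simp add: algebra_simps)
    qed
    then have "closed_segment q far \<inter> frontier K \<noteq> {}"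
      using qK by (intro connected_Int_frontier) auto
    then obtain u where u: "0 \<le> u" "u \<le> 1" "(1 - u) *\<^sub>R q + u *\<^sub>R far \<in> frontier K"
      by (auto simp: closed_segment_def)
    define x where "x = q + (u * M) *\<^sub>R (0, 1)"
    have "(1 - u) *\<^sub>R q + u *\<^sub>R far = x" by (simp add: far_def x_def algebra_simps)
    then have "x \<in> frontier K" using u by simp
    moreover have "0 < snd x" using interior_K_snd[OF q] u M by (simp add: x_def add_pos_nonneg)
    ultimately have "x \<in> S" by (rule upper_frontier_in_S)
    have "\<eta> \<bullet> (x - z) = \<eta> \<bullet> (q - z) + u * M * snd \<eta>"
      by (simp add: x_def inner_add_right inner_diff_right inner_prod_def algebra_simps)
    then have "\<eta> \<bullet> (q - z) \<le> \<eta> \<bullet> (x - z)" using u M \<eta> by simp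
    also have "\<dots> \<le> sup_S z \<eta>" unfolding sup_S_def using \<open>x \<in> S\<close> by (intro cSUP_upper bdd_sup_S)
    finally show "q \<in> {k. \<eta> \<bullet> (k - z) \<le> sup_S z \<eta>}" by simp
  qed
  moreover have "closed {k. \<eta> \<bullet> (k - z) \<le> sup_S z \<eta>}" by (intro closed_Collect_le continuous_intros)
  ultimately have "closure (interior K) \<subseteq> {k. \<eta> \<bullet> (k - z) \<le> sup_S z \<eta>}" by (rule closure_minimal)
  then show ?thesis using k K_closure_interior by auto
qed

lemma sup_S_le:
  assumes z: "z \<in> K" and \<eta>: "norm \<eta> = 1"
  shows "sup_S z \<eta> \<le> diameter K"
  unfolding sup_S_def
proof (rule cSUP_least[OF S_nonempty])
  fix X assume "X \<in> S"
  then have X: "X \<in> K" using S_subset_K by blast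
  have "\<eta> \<bullet> (X - z) \<le> norm \<eta> * norm (X - z)" by (rule norm_cauchy_schwarz)
  also have "\<dots> = dist X z" using \<eta> by (simp add: dist_norm)
  also have "\<dots> \<le> diameter K" by (rule diameter_bounded_bound[OF compact_imp_bounded[OF K_compact] X z])
  finally show "\<eta> \<bullet> (X - z) \<le> diameter K" .
qed

lemma continuous_sup_S: "continuous_on UNIV (sup_S z)"
proof -
  have "bounded ((\<lambda>X. X - z) ` S)"
    by (intro compact_imp_bounded compact_continuous_image compact_S continuous_intros)
  then obtain B where B: "\<And>X. X \<in> S \<Longrightarrow> norm (X - z) \<le> B" by (auto simp: bounded_iff)
  obtain X0 where "X0 \<in> S" using S_nonempty by blast
  then have B0: "0 \<le> B" using B norm_ge_zero order_trans by blast
  have one: "sup_S z \<eta> \<le> sup_S z \<eta>' + B * norm (\<eta> - \<eta>')" for \<eta> \<eta>'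
  proof -
    have "(SUP X\<in>S. \<eta> \<bullet> (X - z)) \<le> sup_S z \<eta>' + B * norm (\<eta> - \<eta>')"
    proof (rule cSUP_least[OF S_nonempty])
      fix X assume X: "X \<in> S"
      have "\<eta>' \<bullet> (X - z) \<le> sup_S z \<eta>'" unfolding sup_S_def using X by (intro cSUP_upper bdd_sup_S)
      moreover have "(\<eta> - \<eta>') \<bullet> (X - z) \<le> norm (\<eta> - \<eta>') * B"
        by (rule order_trans[OF norm_cauchy_schwarz]) (intro mult_left_mono B X norm_ge_zero)
      ultimately show "\<eta> \<bullet> (X - z) \<le> sup_S z \<eta>' + B * norm (\<eta> - \<eta>')"
        by (simp add: inner_diff_left mult.commute)
    qed
    then show ?thesis by (simp only: sup_S_def)
  qed
  have "B-lipschitz_on UNIV (sup_S z)"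
  proof (rule lipschitz_onI[OF _ B0])
    fix \<eta> \<eta>'
    show "dist (sup_S z \<eta>) (sup_S z \<eta>') \<le> B * dist \<eta> \<eta>'"
      using one[of \<eta> \<eta>'] one[of \<eta>' \<eta>] by (auto simp: dist_norm norm_minus_commute abs_le_iff)
  qed
  then show ?thesis by (rule lipschitz_on_continuous_on)
qed

abbreviation flat_interior where
  "flat_interior \<equiv> top_of_set bdry_plane interior_of flat_part K"

lemma flat_interior_iff:
  "z \<in> flat_interior \<longleftrightarrow> snd z = 0 \<and> (\<exists>\<epsilon>>0. \<forall>y. dist (fst z) y < \<epsilon> \<longrightarrow> (y, 0) \<in> K)"
proof
  assume "z \<in> flat_interior"
  then obtain T where T: "openin (top_of_set bdry_plane) T" "z \<in> T" "T \<subseteq> flat_part K"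
    unfolding interior_of_def by blast
  then obtain \<epsilon> where \<epsilon>: "0 < \<epsilon>" "ball z \<epsilon> \<inter> bdry_plane \<subseteq> T" unfolding openin_contains_ball by blast
  have z: "snd z = 0" using T by (auto simp: flat_part_def bdry_plane_def)
  have "(y, 0) \<in> K" if "dist (fst z) y < \<epsilon>" for y
  proof -
    have "dist z (y, 0) = dist (fst z) y" using z by (cases z) (simp add: dist_Pair_Pair)
    then have "(y, 0) \<in> T" using that by (intro subsetD[OF \<epsilon>(2)]) (simp add: bdry_plane_def)
    then show ?thesis using T(3) by (auto simp: flat_part_def)
  qed
  then show "snd z = 0 \<and> (\<exists>\<epsilon>>0. \<forall>y. dist (fst z) y < \<epsilon> \<longrightarrow> (y, 0) \<in> K)" using z \<epsilon> by blast
next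
  assume "snd z = 0 \<and> (\<exists>\<epsilon>>0. \<forall>y. dist (fst z) y < \<epsilon> \<longrightarrow> (y, 0) \<in> K)"
  then obtain \<epsilon> where z: "snd z = 0" and \<epsilon>: "0 < \<epsilon>" "\<And>y. dist (fst z) y < \<epsilon> \<Longrightarrow> (y, 0) \<in> K" by blast
  have "bdry_plane \<inter> ball z \<epsilon> \<subseteq> flat_part K"
  proof
    fix x assume x: "x \<in> bdry_plane \<inter> ball z \<epsilon>"
    have "dist (fst z) (fst x) \<le> dist z x" by (rule dist_fst_le)
    then have "(fst x, 0) \<in> K" using x by (intro \<epsilon>(2)) auto
    then show "x \<in> flat_part K" using x by (cases x) (auto simp: flat_part_def bdry_plane_def)
  qed
  moreover have "openin (top_of_set bdry_plane) (bdry_plane \<inter> ball z \<epsilon>)" by (intro openin_open_Int open_ball)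
  moreover have "z \<in> bdry_plane \<inter> ball z \<epsilon>" using z \<epsilon> by (simp add: bdry_plane_def)
  ultimately show "z \<in> flat_interior" unfolding interior_of_def by blast
qed

lemma flat_interior_in_K: "z \<in> flat_interior \<Longrightarrow> z \<in> K"
  using interior_of_subset[of "top_of_set bdry_plane" "flat_part K"] by (auto simp: flat_part_def)

text \<open>
  If \<open>\<eta>\<close> has a horizontal component, a point of the flat part displaced from \<open>z\<close> along it is a witness; if \<open>\<eta>\<close> is
  vertical, any point above the plane is.
\<close>

lemma sup_S_pos:
  assumes z: "z \<in> flat_interior" and \<eta>: "0 < snd \<eta>"
  shows "0 < sup_S z \<eta>"
proof -
  obtain \<epsilon> where z0: "snd z = 0" and \<epsilon>: "0 < \<epsilon>" "\<And>y. dist (fst z) y < \<epsilon> \<Longrightarrow> (y, 0) \<in> K"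
    using z flat_interior_iff by blast
  show ?thesis
  proof (cases "fst \<eta> = 0")
    case True
    obtain q where q: "q \<in> interior K" using interior_K_ne by blast
    have "0 < snd \<eta> * snd q" using \<eta> interior_K_snd[OF q] by simp
    also have "\<dots> = \<eta> \<bullet> (q - z)" using True z0 by (simp add: inner_prod_def)
    also have "\<dots> \<le> sup_S z \<eta>" using \<eta> q interior_subset by (intro inner_le_sup_S) auto
    finally show ?thesis .
  next
    case False
    define n where "n = norm (fst \<eta>)"
    have n: "0 < n" using False by (simp add: n_def)
    define y where "y = fst z + (\<epsilon> / (2 * n)) *\<^sub>R fst \<eta>"
    have "dist (fst z) y = \<epsilon> / 2" using n \<epsilon>(1) by (simp add: y_def dist_norm n_def[symmetric])
    then have "(y, 0) \<in> K" using \<epsilon> by simp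
    then have "\<eta> \<bullet> ((y, 0) - z) \<le> sup_S z \<eta>" by (rule inner_le_sup_S[OF \<eta>])
    moreover have "\<eta> \<bullet> ((y, 0) - z) = (\<epsilon> / (2 * n)) * (fst \<eta> \<bullet> fst \<eta>)" using z0 by (simp add: inner_prod_def y_def)
    moreover have "0 < (\<epsilon> / (2 * n)) * (fst \<eta> \<bullet> fst \<eta>)" using False n \<epsilon>(1) by simp
    ultimately show ?thesis by linarith
  qed
qed

lemma cap_support_lower_bound:
  assumes z: "z \<in> flat_interior"
  shows "\<exists>m>0. \<forall>\<xi>\<in>cap 1 \<theta> 0. m \<le> cap_support \<theta> S z \<xi>"
proof -
  have nz: "cap_ell \<theta> \<xi> \<noteq> 0" if "\<xi> \<in> cap 1 \<theta> 0" for \<xi> :: "'n amb"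
    using cap_ell_bounds(3)[OF that] by simp
  have "continuous_on (cap 1 \<theta> 0) (\<lambda>\<xi>. sup_S z (\<xi> - cos \<theta> *\<^sub>R e_vec) / cap_ell \<theta> \<xi>)"
    by (intro continuous_on_divide continuous_on_compose2[OF continuous_sup_S] continuous_on_subset[OF cap_ell_continuous] continuous_intros)
       (use nz in auto)
  then obtain \<xi>0 where \<xi>0: "\<xi>0 \<in> cap 1 \<theta> 0" and min: "\<And>\<xi>. \<xi> \<in> cap 1 \<theta> 0 \<Longrightarrow>
      sup_S z (\<xi>0 - cos \<theta> *\<^sub>R e_vec) / cap_ell \<theta> \<xi>0 \<le> sup_S z (\<xi> - cos \<theta> *\<^sub>R e_vec) / cap_ell \<theta> \<xi>"
    using continuous_attains_inf[OF compact_cap cap_ne] by blast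
  have "0 < sup_S z (\<xi>0 - cos \<theta> *\<^sub>R e_vec) / cap_ell \<theta> \<xi>0"
    using sup_S_pos[OF z cap_direction(2)[OF \<xi>0]] cap_ell_bounds(3)[OF \<xi>0] by simp
  then show ?thesis using min unfolding cap_support_eq by blast
qed

definition support_bound where "support_bound = diameter K / (1 - cos \<theta>)"

lemma cap_support_le:
  assumes z: "z \<in> flat_interior" and \<xi>: "\<xi> \<in> cap 1 \<theta> 0"
  shows "cap_support \<theta> S z \<xi> \<le> support_bound"
proof -
  have p: "0 < sup_S z (\<xi> - cos \<theta> *\<^sub>R e_vec)" using sup_S_pos[OF z cap_direction(2)[OF \<xi>]] .
  have le: "sup_S z (\<xi> - cos \<theta> *\<^sub>R e_vec) \<le> diameter K"
    using flat_interior_in_K[OF z] cap_direction(1)[OF \<xi>] by (rule sup_S_le)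
  show ?thesis unfolding cap_support_eq support_bound_def
    using p le cap_ell_bounds(1)[OF \<xi>] cos_lt_1 by (intro frac_le) auto
qed

lemma cap_support_pos:
  assumes z: "z \<in> flat_interior" and \<xi>: "\<xi> \<in> cap 1 \<theta> 0"
  shows "0 < cap_support \<theta> S z \<xi>"
  using cap_support_lower_bound[OF z] \<xi> by (meson less_le_trans)

lemma set_integrable_bounded_cap:
  fixes f :: "'n amb \<Rightarrow> real"
  assumes f: "f \<in> borel_measurable borel" and b: "\<And>\<xi>. \<xi> \<in> cap 1 \<theta> 0 \<Longrightarrow> \<bar>f \<xi>\<bar> \<le> B"
  shows "set_integrable (cap_area \<theta>) (cap 1 \<theta> 0) f"
proof -
  interpret finite_measure "cap_area \<theta> :: 'n amb measure" by (rule finite_cap_area)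
  have Cb: "cap 1 \<theta> (0 :: 'n amb) \<in> sets borel" by (rule borel_closed[OF closed_cap])
  obtain \<xi>0 :: "'n amb" where "\<xi>0 \<in> cap 1 \<theta> 0" using cap_ne by blast
  then have B0: "0 \<le> B" using b abs_ge_zero order_trans by blast
  show ?thesis unfolding set_integrable_def
  proof (rule integrable_const_bound[where B = B])
    show "AE \<xi> in cap_area \<theta>. norm (indicator (cap 1 \<theta> 0) \<xi> *\<^sub>R f \<xi>) \<le> B"
    proof (intro AE_I2)
      fix \<xi> :: "'n amb"
      show "norm (indicator (cap 1 \<theta> 0) \<xi> *\<^sub>R f \<xi>) \<le> B"
        using b[of \<xi>] B0 by (cases "\<xi> \<in> cap 1 \<theta> 0") auto
    qed
    show "(\<lambda>\<xi>. indicator (cap 1 \<theta> 0) \<xi> *\<^sub>R f \<xi>) \<in> borel_measurable (cap_area \<theta>)"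
      unfolding measurable_cong_sets[OF sets_cap_area refl]
      by (intro borel_measurable_scaleR borel_measurable_indicator Cb f)
  qed
qed

lemma cap_support_measurable: "cap_support \<theta> S z \<in> borel_measurable borel"
proof -
  have "continuous_on UNIV (\<lambda>\<xi>. sup_S z (\<xi> - cos \<theta> *\<^sub>R e_vec))"
    by (intro continuous_on_compose2[OF continuous_sup_S] continuous_intros) auto
  then have "(\<lambda>\<xi>. sup_S z (\<xi> - cos \<theta> *\<^sub>R e_vec) / cap_ell \<theta> \<xi>) \<in> borel_measurable borel"
    by (intro borel_measurable_divide borel_measurable_continuous_onI cap_ell_continuous)
  then show ?thesis by (simp add: cap_support_eq[abs_def])
qed

lemma cap_ell_integrable: "set_integrable (cap_area \<theta>) (cap 1 \<theta> (0 :: 'n amb)) (cap_ell \<theta>)"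
  using cap_ell_bounds
  by (intro set_integrable_bounded_cap[where B = 1] borel_measurable_continuous_onI cap_ell_continuous) force

lemma ln_support_integrable:
  assumes z: "z \<in> flat_interior"
  shows "set_integrable (cap_area \<theta>) (cap 1 \<theta> 0) (\<lambda>\<xi>. ln (cap_support \<theta> S z \<xi>) * cap_ell \<theta> \<xi>)"
proof -
  obtain m where m: "0 < m" "\<And>\<xi>. \<xi> \<in> cap 1 \<theta> 0 \<Longrightarrow> m \<le> cap_support \<theta> S z \<xi>"
    using cap_support_lower_bound[OF z] by blast
  define B where "B = max \<bar>ln m\<bar> \<bar>ln support_bound\<bar>"
  show ?thesis
  proof (rule set_integrable_bounded_cap[where B = B])
    show "(\<lambda>\<xi>. ln (cap_support \<theta> S z \<xi>) * cap_ell \<theta> \<xi>) \<in> borel_measurable borel"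
      by (intro borel_measurable_times borel_measurable_ln cap_support_measurable
          borel_measurable_continuous_onI cap_ell_continuous)
    fix \<xi> :: "'n amb" assume \<xi>: "\<xi> \<in> cap 1 \<theta> 0"
    have "ln m \<le> ln (cap_support \<theta> S z \<xi>)" using m(1) m(2)[OF \<xi>] by simp
    moreover have "ln (cap_support \<theta> S z \<xi>) \<le> ln support_bound"
      using cap_support_pos[OF z \<xi>] cap_support_le[OF z \<xi>] by simp
    ultimately have "\<bar>ln (cap_support \<theta> S z \<xi>)\<bar> \<le> B" by (auto simp: B_def)
    moreover have "\<bar>cap_ell \<theta> \<xi>\<bar> \<le> 1" using cap_ell_bounds[OF \<xi>] by simp
    ultimately have "\<bar>ln (cap_support \<theta> S z \<xi>)\<bar> * \<bar>cap_ell \<theta> \<xi>\<bar> \<le> B * 1" by (intro mult_mono) auto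
    then show "\<bar>ln (cap_support \<theta> S z \<xi>) * cap_ell \<theta> \<xi>\<bar> \<le> B" by (simp add: abs_mult)
  qed
qed

definition log_mean :: "'n amb \<Rightarrow> real" where
  "log_mean z = 1 / cap_omega TYPE('n) \<theta> *
     (LINT \<xi>:cap 1 \<theta> 0|cap_area \<theta>. ln (cap_support \<theta> S z \<xi>) * cap_ell \<theta> \<xi>)"

text \<open>
  The entropy is a genuine supremum: support functions are uniformly bounded by the diameter of the body, so
  the logarithmic means are bounded above.
\<close>

lemma log_mean_le_entropy:
  assumes z: "z \<in> flat_interior"
  shows "log_mean z \<le> cap_entropy \<theta> S"
proof -
  have "log_mean w \<le> ln support_bound" if w: "w \<in> flat_interior" for w
  proof -
    have "(LINT \<xi>:cap 1 \<theta> 0|cap_area \<theta>. ln (cap_support \<theta> S w \<xi>) * cap_ell \<theta> \<xi>)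
      \<le> (LINT \<xi>:cap 1 \<theta> 0|cap_area \<theta>. ln support_bound * cap_ell \<theta> (\<xi> :: 'n amb))"
    proof (rule set_integral_mono[OF ln_support_integrable[OF w] set_integrable_mult_right[OF cap_ell_integrable]])
      fix \<xi> :: "'n amb" assume \<xi>: "\<xi> \<in> cap 1 \<theta> 0"
      show "ln (cap_support \<theta> S w \<xi>) * cap_ell \<theta> \<xi> \<le> ln support_bound * cap_ell \<theta> \<xi>"
        using cap_support_pos[OF w \<xi>] cap_support_le[OF w \<xi>] cap_ell_bounds(3)[OF \<xi>]
        by (intro mult_right_mono) auto
    qed
    also have "\<dots> = ln support_bound * cap_omega TYPE('n) \<theta>" by (simp add: integral_ell)
    finally show ?thesis using cap_omega_pos[where ?'n = 'n] by (simp add: log_mean_def divide_le_eq)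
  qed
  then have "bdd_above (log_mean ` flat_interior)" by (intro bdd_aboveI2)
  then show ?thesis using z unfolding cap_entropy_def log_mean_def[abs_def] by (intro cSUP_upper)
qed

end

definition (in acute_angle) slab_const :: "'n::finite itself \<Rightarrow> real" where
  "slab_const _ = 3 * measure lborel (cball (0::real^'n) 2) / cos \<theta>"

text \<open>
  The summand \<open>ln 4\<close> comes from the factor \<open>D / 4\<close>; the other one bounds the mean of \<open>- ln \<bar>fst \<xi> \<bullet> d\<bar>\<close>, where the factor 2 is the
  sum of the geometric series of slab areas.
\<close>

definition (in acute_angle) entropy_const :: "'n::finite itself \<Rightarrow> real" where
  "entropy_const t = ln 4 + 2 * ln 2 * slab_const t / cap_omega t \<theta>"

context convex_capillary
begin

text \<open>
  A positive lower bound of the support function permits cutting off \<open>\<bar>fst \<xi> \<bullet> d\<bar>\<close> at some \<open>(1/2) ^ N\<close>. After the dyadic bound for the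
  logarithm, the integral is controlled by the areas of the slabs, which decay geometrically.
\<close>

lemma log_mean_ge:
  assumes z: "z \<in> flat_interior" and d: "norm d = 1" and D: "0 < D"
    and u: "\<And>\<xi>. \<xi> \<in> cap 1 \<theta> 0 \<Longrightarrow> D / 4 * \<bar>fst \<xi> \<bullet> d\<bar> \<le> cap_support \<theta> S z \<xi>"
  shows "ln D - entropy_const TYPE('n) \<le> log_mean z"
proof -
  interpret finite_measure "cap_area \<theta> :: 'n amb measure" by (rule finite_cap_area)
  let ?M = "cap_area \<theta> :: 'n amb measure" and ?C = "cap 1 \<theta> (0 :: 'n amb)"
  define slab where "slab j = {\<xi> :: 'n amb. \<bar>fst \<xi> \<bullet> d\<bar> \<le> (1/2) ^ j}" for j :: nat
  define c where "c = slab_const TYPE('n)"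
  have slab_b: "slab j \<in> sets borel" for j
    unfolding slab_def by (intro borel_closed closed_Collect_le continuous_intros)
  obtain m where m: "0 < m" "\<And>\<xi>. \<xi> \<in> ?C \<Longrightarrow> m \<le> cap_support \<theta> S z \<xi>"
    using cap_support_lower_bound[OF z] by blast
  obtain N where N: "(1/2) ^ N < 4 * m / D" using real_arch_pow_inv[of "4 * m / D" "1/2"] m(1) D by auto
  have point: "ln (D / 4) * cap_ell \<theta> \<xi> - ln 2 * (\<Sum>j<N. indicat_real (slab j) \<xi>) \<le> ln (cap_support \<theta> S z \<xi>) * cap_ell \<theta> \<xi>"
    if \<xi>: "\<xi> \<in> ?C" for \<xi>
  proof -
    define v where "v = \<bar>fst \<xi> \<bullet> d\<bar>"
    define w where "w = (\<Sum>j<N. indicat_real (slab j) \<xi>)"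
    have w: "w = (\<Sum>j<N. if v \<le> (1/2) ^ j then 1 else 0)"
      unfolding w_def by (intro sum.cong refl) (auto simp: slab_def v_def indicator_def)
    have w0: "0 \<le> w" unfolding w_def by (intro sum_nonneg) auto
    have mx: "0 < max ((1/2) ^ N) v" by (simp add: less_max_iff_disj)
    have "D / 4 * (1/2) ^ N \<le> m" using N D by (simp add: field_simps)
    then have "D / 4 * max ((1/2) ^ N) v \<le> cap_support \<theta> S z \<xi>"
      using m(2)[OF \<xi>] u[OF \<xi>] by (auto simp: max_def v_def)
    then have "ln (D / 4 * max ((1/2) ^ N) v) \<le> ln (cap_support \<theta> S z \<xi>)"
      using mx D by (intro ln_mono) auto
    moreover have "ln (D / 4 * max ((1/2) ^ N) v) = ln (D / 4) + ln (max ((1/2) ^ N) v)"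
      using mx D by (intro ln_mult_pos) auto
    moreover have "- ln 2 * w \<le> ln (max ((1/2) ^ N) v)"
      unfolding w by (rule ln_max_ge_neg_dyadic_sum)
    ultimately have "ln (D / 4) - ln 2 * w \<le> ln (cap_support \<theta> S z \<xi>)" by simp
    then have "(ln (D / 4) - ln 2 * w) * cap_ell \<theta> \<xi> \<le> ln (cap_support \<theta> S z \<xi>) * cap_ell \<theta> \<xi>"
      using cap_ell_bounds(3)[OF \<xi>] by (intro mult_right_mono) auto
    moreover have "ln 2 * w * cap_ell \<theta> \<xi> \<le> ln 2 * w * 1"
      using w0 cap_ell_bounds(2)[OF \<xi>] by (intro mult_left_mono) auto
    ultimately show ?thesis by (simp add: w_def[symmetric] algebra_simps)
  qed
  have si: "set_integrable ?M ?C (\<lambda>\<xi>. indicat_real (slab j) \<xi>)" for j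
    by (rule set_integrable_bounded_cap[where B = 1, OF borel_measurable_indicator[OF slab_b]])
       (simp add: indicator_def)
  have sw: "set_integrable ?M ?C (\<lambda>\<xi>. \<Sum>j<N. indicat_real (slab j) \<xi>)"
    unfolding set_integrable_def scaleR_sum_right
    by (intro Bochner_Integration.integrable_sum si[unfolded set_integrable_def])
  have slab_int: "(LINT \<xi>:?C|?M. indicat_real (slab j) \<xi>) \<le> c * (1/2) ^ j" for j
  proof -
    have "(LINT \<xi>:?C|?M. indicat_real (slab j) \<xi>) = (\<integral>\<xi>. indicat_real (?C \<inter> slab j) \<xi> \<partial>?M)"
      unfolding set_lebesgue_integral_def by (intro Bochner_Integration.integral_cong) (auto simp: indicator_def)
    also have "\<dots> = measure ?M (?C \<inter> slab j)" by simp
    also have "\<dots> \<le> measure ?M (slab j)" using slab_b by (intro finite_measure_mono) (auto simp: sets_cap_area)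
    also have "\<dots> \<le> c * (1/2) ^ j"
      unfolding slab_def c_def slab_const_def by (rule cap_slab_measure_le[OF d]) (auto simp: power_le_one)
    finally show ?thesis .
  qed
  have c0: "0 \<le> c" using cos_pos by (simp add: c_def slab_const_def)
  have "(LINT \<xi>:?C|?M. (\<Sum>j<N. indicat_real (slab j) \<xi>)) = (\<Sum>j<N. LINT \<xi>:?C|?M. indicat_real (slab j) \<xi>)"
    unfolding set_lebesgue_integral_def scaleR_sum_right
    by (intro Bochner_Integration.integral_sum si[unfolded set_integrable_def])
  also have "\<dots> \<le> (\<Sum>j<N. c * (1/2) ^ j)" by (intro sum_mono slab_int)
  also have "\<dots> = c * (\<Sum>j<N. (1/2) ^ j)" by (simp add: sum_distrib_left)
  also have "(\<Sum>j<N. (1/2) ^ j) = 2 * (1 - (1/2 :: real) ^ N)" by (simp add: sum_gp_strict)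
  also have "c * \<dots> \<le> c * 2" using c0 by (intro mult_left_mono) auto
  finally have sum_le: "(LINT \<xi>:?C|?M. (\<Sum>j<N. indicat_real (slab j) \<xi>)) \<le> c * 2" .
  define om where "om = cap_omega TYPE('n) \<theta>"
  have om: "0 < om" unfolding om_def by (rule cap_omega_pos)
  have "ln (D / 4) * om - ln 2 * (c * 2) \<le> ln (D / 4) * om - ln 2 * (LINT \<xi>:?C|?M. (\<Sum>j<N. indicat_real (slab j) \<xi>))"
    using sum_le by (intro diff_left_mono mult_left_mono) auto
  also have "\<dots> = (LINT \<xi>:?C|?M. ln (D / 4) * cap_ell \<theta> \<xi> - ln 2 * (\<Sum>j<N. indicat_real (slab j) \<xi>))"
    using cap_ell_integrable sw
    by (subst set_integral_diff(2)) (simp_all only: set_integrable_mult_right set_integral_mult_right integral_ell om_def)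
  also have "\<dots> \<le> (LINT \<xi>:?C|?M. ln (cap_support \<theta> S z \<xi>) * cap_ell \<theta> \<xi>)"
    by (intro set_integral_mono set_integral_diff(1) set_integrable_mult_right cap_ell_integrable sw
        ln_support_integrable[OF z] point)
  finally have "(ln (D / 4) * om - ln 2 * (c * 2)) / om \<le> log_mean z"
    using om unfolding log_mean_def om_def[symmetric] by (simp add: divide_right_mono)
  moreover have "(ln (D / 4) * om - ln 2 * (c * 2)) / om = ln D - entropy_const TYPE('n)"
    using om D by (simp add: entropy_const_def c_def[symmetric] om_def[symmetric] ln_div field_simps)
  ultimately show ?thesis by simp
qed

text \<open>
  The base points \<open>a\<close> and \<open>b\<close> realize the diameter. Their midpoint need not be interior to the base, so \<open>z\<close> is taken half-way
  between the midpoint and the interior point \<open>z0\<close>. Half the value at \<open>a\<close> plus half the value at \<open>z0\<close> then gives a quarter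
  of \<open>\<eta> \<bullet> (a - b)\<close>, and exchanging \<open>a\<close> and \<open>b\<close> gives the absolute value.
\<close>

lemma ln_width_le_entropy: "ln width - entropy_const TYPE('n) \<le> cap_entropy \<theta> S"
proof -
  obtain a b where ab: "a \<in> base" "b \<in> base" "dist a b = width" using width_attained by blast
  obtain z0 \<delta> where z0: "0 < \<delta>" "\<And>y. dist z0 y < \<delta> \<Longrightarrow> (y, 0) \<in> K" by (rule flat_interior_exists) blast
  have aK: "(a, 0) \<in> K" "(b, 0) \<in> K" "(z0, 0) \<in> K" using ab z0 by (auto simp: base_def)
  define mid where "mid = (1/2) *\<^sub>R (a + b)"
  have "(a, 0) + (1/2) *\<^sub>R ((b, 0) - (a, 0)) \<in> K" using aK by (intro segment_in_K) auto
  moreover have "(a, 0) + (1/2) *\<^sub>R ((b, 0) - (a, 0)) = (mid, 0 :: real)"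
    by (simp add: mid_def scaleR_add_right scaleR_diff_right)
  ultimately have midK: "(mid, 0) \<in> K" by simp
  define z :: "'n amb" where "z = ((1/2) *\<^sub>R (mid + z0), 0)"
  have zI: "z \<in> flat_interior"
    unfolding flat_interior_iff
  proof (intro conjI exI[of _ "\<delta> / 2"] allI impI)
    fix y assume y: "dist (fst z) y < \<delta> / 2"
    define w where "w = 2 *\<^sub>R y - mid"
    have "z0 - w = 2 *\<^sub>R (fst z - y)" by (simp add: w_def z_def algebra_simps)
    then have "dist z0 w = 2 * dist (fst z) y" by (simp add: dist_norm)
    then have "(w, 0) \<in> K" using y by (intro z0(2)) simp
    then have "(mid, 0) + (1/2) *\<^sub>R ((w, 0) - (mid, 0)) \<in> K" using midK by (intro segment_in_K) auto
    moreover have "mid + (1/2) *\<^sub>R (w - mid) = y" by (simp add: w_def vec_eq_iff field_simps)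
    ultimately show "(y, 0) \<in> K" by simp
  qed (use z0 in \<open>auto simp: z_def\<close>)
  define d where "d = (1 / width) *\<^sub>R (a - b)"
  have d: "norm d = 1" using ab(3) width_pos by (simp add: d_def dist_norm)
  have "width / 4 * \<bar>fst \<xi> \<bullet> d\<bar> \<le> cap_support \<theta> S z \<xi>" if \<xi>: "\<xi> \<in> cap 1 \<theta> 0" for \<xi>
  proof -
    define \<eta> where "\<eta> = \<xi> - cos \<theta> *\<^sub>R e_vec"
    define y where "y = fst \<eta>"
    have y: "y = fst \<xi>" unfolding y_def \<eta>_def by (rule cap_direction(3)[OF \<xi>])
    have \<eta>: "0 < snd \<eta>" unfolding \<eta>_def by (rule cap_direction(2)[OF \<xi>])
    have ev: "\<eta> \<bullet> ((p, 0) - z) = y \<bullet> p - (y \<bullet> a + y \<bullet> b) / 4 - y \<bullet> z0 / 2" for p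
      by (simp add: inner_prod_def z_def mid_def y_def inner_diff_right inner_add_right algebra_simps)
    have le: "y \<bullet> p - (y \<bullet> a + y \<bullet> b) / 4 - y \<bullet> z0 / 2 \<le> sup_S z \<eta>" if "(p, 0) \<in> K" for p
      using inner_le_sup_S[OF \<eta> that, of z] unfolding ev .
    have "\<bar>y \<bullet> a - y \<bullet> b\<bar> / 4 \<le> sup_S z \<eta>"
      using le[OF aK(1)] le[OF aK(2)] le[OF aK(3)] by (simp add: abs_if field_simps)
    moreover have "width * (y \<bullet> d) = y \<bullet> a - y \<bullet> b" using width_pos by (simp add: d_def inner_diff_right)
    then have "width / 4 * \<bar>y \<bullet> d\<bar> = \<bar>y \<bullet> a - y \<bullet> b\<bar> / 4" using width_pos by (metis abs_mult abs_of_pos times_divide_eq_left)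
    ultimately have "width / 4 * \<bar>y \<bullet> d\<bar> \<le> sup_S z \<eta>" by simp
    also have "\<dots> \<le> sup_S z \<eta> / cap_ell \<theta> \<xi>"
      using sup_S_pos[OF zI \<eta>] cap_ell_bounds(2,3)[OF \<xi>] by (simp add: le_divide_eq mult_left_le)
    finally show ?thesis by (simp add: cap_support_eq \<eta>_def y)
  qed
  then have "ln width - entropy_const TYPE('n) \<le> log_mean z" by (rule log_mean_ge[OF zI d width_pos])
  also have "\<dots> \<le> cap_entropy \<theta> S" by (rule log_mean_le_entropy[OF zI])
  finally show ?thesis .
qed

lemma width_le_exp_entropy: "width \<le> exp (entropy_const TYPE('n)) * exp (cap_entropy \<theta> S)"
proof -
  have "width = exp (ln width)" using width_pos by simp
  also have "\<dots> \<le> exp (entropy_const TYPE('n) + cap_entropy \<theta> S)" using ln_width_le_entropy by simp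
  finally show ?thesis by (simp add: exp_add)
qed

end

theorem proposition4p8:
  fixes \<theta> :: real
  assumes "0 < \<theta>" and "\<theta> < pi / 2"
  shows "\<exists>C>0. \<forall>S :: 'n::finite amb set.
    capillary_hypersurface \<theta> S \<and> convex (enclosed S) \<longrightarrow>
      outer_radius \<theta> (enclosed S) \<le> C * exp (cap_entropy \<theta> S) \<and>
      inner_radius \<theta> (enclosed S) \<ge>
        inverse C * measure lborel (enclosed S) * exp (- real CARD('n) * cap_entropy \<theta> S)"
proof -
  interpret acute_angle \<theta> using assms by unfold_locales
  define B where "B = exp (entropy_const TYPE('n))"
  define m where "m = (2 + 1 / (cos \<theta>)\<^sup>2) / sin \<theta>"
  define k where "k = (2 * B) ^ CARD('n) * (1 + tan \<theta>)"
  define C where "C = max (m * B) k"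
  have T: "0 < tan \<theta>" using assms by (rule tan_gt_zero)
  have B: "0 < B" by (simp add: B_def)
  have m: "0 < m" using sin_pos by (simp add: m_def add_pos_nonneg)
  have C: "0 < C" using B m by (simp add: C_def less_max_iff_disj)
  show ?thesis
  proof (intro exI[of _ C] conjI allI impI C)
    fix S :: "'n amb set"
    assume S: "capillary_hypersurface \<theta> S \<and> convex (enclosed S)"
    then obtain \<nu> where \<nu>: "outward_unit_normal S \<nu>" "\<forall>p\<in>mfd_boundary S. \<nu> p \<bullet> e_vec = - cos \<theta>"
      by (auto simp: capillary_hypersurface_def)
    interpret convex_capillary \<theta> S \<nu>
    proof
      fix p assume "p \<in> S" "snd p = 0"
      then have "p \<in> mfd_boundary S" using S by (auto simp: capillary_hypersurface_def bdry_plane_def)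
      then have "\<nu> p \<bullet> e_vec = - cos \<theta>" using \<nu>(2) by blast
      then show "snd (\<nu> p) = cos \<theta>" by (simp add: e_vec_def inner_prod_def)
    qed (use S \<nu> in \<open>auto simp: capillary_hypersurface_def\<close>)
    define E where "E = cap_entropy \<theta> S"
    have w: "width \<le> B * exp E" unfolding B_def E_def by (rule width_le_exp_entropy)
    have "outer_radius \<theta> (enclosed S) \<le> m * width" unfolding m_def by (rule outer_radius_le)
    also have "\<dots> \<le> m * (B * exp E)" using w m by (intro mult_left_mono) auto
    also have "\<dots> = (m * B) * exp E" by (simp only: mult.assoc)
    also have "\<dots> \<le> C * exp E" unfolding C_def by (intro mult_right_mono) auto
    finally show "outer_radius \<theta> (enclosed S) \<le> C * exp (cap_entropy \<theta> S)" by (simp only: E_def)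
    have r: "0 \<le> inner_radius \<theta> (enclosed S)"
    proof -
      obtain q where q: "q \<in> interior (enclosed S)" using interior_K_ne by blast
      have "0 \<le> snd q / (1 + tan \<theta>)" using interior_K_snd[OF q] T by simp
      also have "\<dots> \<le> inner_radius \<theta> (enclosed S)"
        using q interior_subset interior_K_snd[OF q] by (intro inner_radius_ge) auto
      finally show ?thesis .
    qed
    have "measure lborel (enclosed S) \<le> (2 * width) ^ CARD('n) * (1 + tan \<theta>) * inner_radius \<theta> (enclosed S)"
      by (rule volume_le)
    also have "\<dots> \<le> (2 * (B * exp E)) ^ CARD('n) * (1 + tan \<theta>) * inner_radius \<theta> (enclosed S)"
      using w width_pos T r by (intro mult_right_mono power_mono mult_left_mono) auto
    also have "\<dots> = k * exp (real CARD('n) * E) * inner_radius \<theta> (enclosed S)"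
      unfolding k_def exp_of_nat_mult power_mult_distrib by (simp only: mult_ac)
    also have "\<dots> \<le> C * exp (real CARD('n) * E) * inner_radius \<theta> (enclosed S)"
      unfolding C_def using r by (intro mult_right_mono) auto
    finally have v: "measure lborel (enclosed S) \<le> C * exp (real CARD('n) * E) * inner_radius \<theta> (enclosed S)" .
    have "inverse C * measure lborel (enclosed S) * exp (- real CARD('n) * E)
        \<le> inverse C * (C * exp (real CARD('n) * E) * inner_radius \<theta> (enclosed S)) * exp (- real CARD('n) * E)"
      using v C by (intro mult_right_mono mult_left_mono) auto
    also have "\<dots> = inner_radius \<theta> (enclosed S)" using C by (simp add: exp_minus field_simps)
    finally show "inner_radius \<theta> (enclosed S) \<ge>
        inverse C * measure lborel (enclosed S) * exp (- real CARD('n) * cap_entropy \<theta> S)"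
      by (simp only: E_def)
  qed
qed

end
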